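(* Suppose that $f(\cdot;\xi)$ is convex and $L$-smooth for every realization of $\xi$ (with $L>0$), that $F$ has a minimizer $w_*$, and that there is $\sigma_*>0$ with $\mathbb{E}[\|\nabla f(w_*;\xi)\|^2]\le\sigma_*^2$. Let $w_0\in\mathbb{R}^d$ be given, and let $\tilde w$ be the output of iSARAH-IN$(w_0,\eta,m,b)$ with learning rate $\eta=\frac{1}{L\sqrt{m+1}}$ and sample size $b=2\sqrt{m+1}$, where $m$ (such that $2\sqrt{m+1}$ is an integer) is the total number of iterations. Then $\|\nabla F(\tilde w)\|^2$ converges sublinearly in expectation with rate $$\mathbb{E}[\|\nabla F(\tilde w)\|^2]=\mathcal{O}\left(\frac{\max\{L,\sigma_*^2\}}{\sqrt{m+1}}\right),$$ and therefore the total complexity to achieve an $\epsilon$-accurate solution, i.e. $\mathbb{E}[\|\nabla F(\tilde w)\|^2]\le\epsilon$ (for a suitable choice of $m$ depending on $\epsilon$), is $$\mathcal{O}\left(\frac{\max\{L,\sigma_*^2\}}{\epsilon}+\frac{\max\{L^2,\sigma_*^4\}}{\epsilon^2}\right).$$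
   Context: $\xi$ is a random variable; for each realization, $f(\cdot;\xi):\mathbb{R}^d\to\mathbb{R}$ is differentiable; $F(w)=\mathbb{E}[f(w;\xi)]$ is bounded below, and $\mathbb{E}[\nabla f(w;\xi)]=\nabla F(w)$ for every fixed $w\in\mathbb{R}^d$. $\|\cdot\|$ is the Euclidean norm. $L$-smooth for every realization means $\|\nabla f(w;\xi)-\nabla f(w';\xi)\|\le L\|w-w'\|$ for all $w,w'\in\mathbb{R}^d$ and every realization of $\xi$. The procedure iSARAH-IN$(w_0,\eta,m,b)$ has parameters $\eta>0$ and positive integers $m,b$. Let $\zeta_1,\dots,\zeta_b,\xi_1,\xi_2,\dots$ be i.i.d. copies of $\xi$, independent of $w_0$. Set $$v_0=\frac1b\sum_{i=1}^b\nabla f(w_0;\zeta_i),\qquad w_1=w_0-\eta v_0,$$ and for $t\ge 1$ $$v_t=\nabla f(w_t;\xi_t)-\nabla f(w_{t-1};\xi_t)+v_{t-1},\qquad w_{t+1}=w_t-\eta v_t.$$ The output is $\tilde w=w_t$ with $t$ chosen uniformly at random from $\{0,1,\dots,m\}$, independently of everything else. The total complexity of one run is its number of stochastic gradient evaluations, counted as $b+2m$. The $\mathcal{O}(\cdot)$ in the complexity is for $\epsilon\to0$ (sufficiently small $\epsilon>0$), and the constants hidden in $\mathcal{O}(\cdot)$ depend only on $F(w_0)-F(w_* )$. *)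

theory Defs
  imports "HOL-Probability.Probability"
begin

definition grad :: "(real ^ 'd \<Rightarrow> real) \<Rightarrow> real ^ 'd \<Rightarrow> real ^ 'd" where
  "grad h w = (THE g. GDERIV h w :> g)"

(* The random variable xi enters through its law D; the points of space D are its realizations,
   and f w z stands for f(w; z). *)

definition stoch_grad :: "(real ^ 'd \<Rightarrow> 'z \<Rightarrow> real) \<Rightarrow> real ^ 'd \<Rightarrow> 'z \<Rightarrow> real ^ 'd" where
  "stoch_grad f w z = grad (\<lambda>u. f u z) w"

definition expected_loss :: "'z measure \<Rightarrow> (real ^ 'd \<Rightarrow> 'z \<Rightarrow> real) \<Rightarrow> real ^ 'd \<Rightarrow> real" where
  "expected_loss D f w = (\<integral>z. f w z \<partial>D)"

definition stochastic_objective :: "'z measure \<Rightarrow> (real ^ 'd \<Rightarrow> 'z \<Rightarrow> real) \<Rightarrow> bool" where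
  "stochastic_objective D f \<longleftrightarrow>
     prob_space D \<and>
     (\<forall>z\<in>space D. \<forall>w. (\<lambda>u. f u z) differentiable (at w)) \<and>
     (\<forall>w. integrable D (f w)) \<and>
     bdd_below (range (expected_loss D f)) \<and>
     (\<forall>w. expected_loss D f differentiable (at w) \<and>
          integrable D (stoch_grad f w) \<and>
          (\<integral>z. stoch_grad f w z \<partial>D) = grad (expected_loss D f) w)"

definition smooth_realizations ::
    "'z measure \<Rightarrow> (real ^ 'd \<Rightarrow> 'z \<Rightarrow> real) \<Rightarrow> real \<Rightarrow> bool" where
  "smooth_realizations D f L \<longleftrightarrow>
     (\<forall>z\<in>space D. \<forall>w w'. norm (stoch_grad f w z - stoch_grad f w' z) \<le> L * norm (w - w'))"

(* The recursion along one sample path: z 1, ..., z b form the initial batch and x t is the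
   sample used in step t; z 0 and x 0 are never used. *)

context
  fixes f :: "real ^ 'd \<Rightarrow> 'z \<Rightarrow> real" and w0 :: "real ^ 'd" and \<eta> :: real and b :: nat
    and z x :: "nat \<Rightarrow> 'z"
begin

fun isarah_w :: "nat \<Rightarrow> real ^ 'd" and isarah_v :: "nat \<Rightarrow> real ^ 'd" where
  "isarah_w 0 = w0"
| "isarah_w (Suc t) = isarah_w t - \<eta> *\<^sub>R isarah_v t"
| "isarah_v 0 = (1 / real b) *\<^sub>R (\<Sum>i = 1..b. stoch_grad f w0 (z i))"
| "isarah_v (Suc t) =
     stoch_grad f (isarah_w (Suc t)) (x (Suc t)) - stoch_grad f (isarah_w t) (x (Suc t))
       + isarah_v t"

end

(* The randomness of one run: i.i.d. samples with law D and an output index that is uniform on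
   {0..m} and independent of all the samples jointly. The last independence is put in terms of the
   generated sigma-algebras because indep_var needs both variables to have the same type of values. *)

definition isarah_samples ::
    "'z measure \<Rightarrow> nat \<Rightarrow> nat \<Rightarrow> 'p measure \<Rightarrow> (nat \<Rightarrow> 'p \<Rightarrow> 'z) \<Rightarrow> (nat \<Rightarrow> 'p \<Rightarrow> 'z) \<Rightarrow> ('p \<Rightarrow> nat) \<Rightarrow> bool"
  where
  "isarah_samples D m b M \<zeta> \<xi> \<tau> \<longleftrightarrow>
     (let I = Inl ` {1..b} \<union> Inr ` {1..}; X = case_sum \<zeta> \<xi> in
        prob_space M \<and>
        prob_space.indep_vars M (\<lambda>_. D) X I \<and>
        (\<forall>j\<in>I. distr M D (X j) = D) \<and>
        \<tau> \<in> measurable M (count_space UNIV) \<and>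
        prob_space.indep_set M
          (sets (vimage_algebra (space M) \<tau> (count_space UNIV)))
          (sets (vimage_algebra (space M) (\<lambda>\<omega>. \<lambda>j\<in>I. X j \<omega>) (Pi\<^sub>M I (\<lambda>_. D)))) \<and>
        distr M (count_space UNIV) \<tau> = measure_pmf (pmf_of_set {0..m}))"

definition isarah_output ::
    "(real ^ 'd \<Rightarrow> 'z \<Rightarrow> real) \<Rightarrow> real ^ 'd \<Rightarrow> real \<Rightarrow> nat \<Rightarrow>
     (nat \<Rightarrow> 'p \<Rightarrow> 'z) \<Rightarrow> (nat \<Rightarrow> 'p \<Rightarrow> 'z) \<Rightarrow> ('p \<Rightarrow> nat) \<Rightarrow> 'p \<Rightarrow> real ^ 'd" where
  "isarah_output f w0 \<eta> b \<zeta> \<xi> \<tau> \<omega> =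
     isarah_w f w0 \<eta> b (\<lambda>i. \<zeta> i \<omega>) (\<lambda>t. \<xi> t \<omega>) (\<tau> \<omega>)"

definition isarah_complexity :: "nat \<Rightarrow> nat \<Rightarrow> nat" where
  "isarah_complexity m b = b + 2 * m"

(* The factors hidden in the O-notation depend only on F(w0) - F(wstar), called \<Delta> here. An
   existential quantifier inside a theorem is always below the implicit quantification over its
   type variables, so it would let the factor depend on the dimension CARD('d) and on the types
   of the realizations and of the sample space; therefore the factors are fixed here as closed
   functions of \<Delta>. No attempt is made to choose them optimally. *)

definition rate_factor :: "real \<Rightarrow> real" where
  "rate_factor \<Delta> = 10 * (\<Delta> + 1)"

definition complexity_factor :: "real \<Rightarrow> real" where
  "complexity_factor \<Delta> = 10 * (rate_factor \<Delta>)\<^sup>2"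

end

theory Submission
  imports Defs
begin

text \<open>Write \<open>e\<^sub>t = \<nabla>F(w\<^sub>t) - v\<^sub>t\<close>. The descent lemma for \<open>F\<close> with \<open>L \<eta> \<le> 1\<close> gives, along every sample
  path, \<open>\<Sum>\<^sub>t \<parallel>\<nabla>F(w\<^sub>t)\<parallel>\<^sup>2 \<le> 2 (F(w\<^sub>0) - F(w\<^sub>*)) / \<eta> + \<Sum>\<^sub>t \<parallel>e\<^sub>t\<parallel>\<^sup>2\<close>. Since \<open>v\<^sub>t\<^sub>+\<^sub>1 - v\<^sub>t\<close> is conditionally
  unbiased for \<open>\<nabla>F(w\<^sub>t\<^sub>+\<^sub>1) - \<nabla>F(w\<^sub>t)\<close>, the error satisfies
  \<open>E \<parallel>e\<^sub>t\<^sub>+\<^sub>1\<parallel>\<^sup>2 \<le> E \<parallel>e\<^sub>t\<parallel>\<^sup>2 + E \<parallel>v\<^sub>t\<^sub>+\<^sub>1 - v\<^sub>t\<parallel>\<^sup>2\<close>, and cocoercivity makes the increments telescope: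
  \<open>\<parallel>v\<^sub>t\<^sub>+\<^sub>1 - v\<^sub>t\<parallel>\<^sup>2 \<le> L \<eta> (\<parallel>v\<^sub>t\<parallel>\<^sup>2 - \<parallel>v\<^sub>t\<^sub>+\<^sub>1\<parallel>\<^sup>2)\<close>. Hence \<open>E \<parallel>e\<^sub>t\<parallel>\<^sup>2 \<le> (1/b + L \<eta>) E \<parallel>\<nabla>f(w\<^sub>0; \<xi>)\<parallel>\<^sup>2\<close>,
  where the second moment is at most \<open>4 L (F(w\<^sub>0) - F(w\<^sub>*)) + 2 \<sigma>\<^sub>*\<^sup>2\<close>.\<close>

section \<open>Convex functions with Lipschitz gradient\<close>

text \<open>\<open>grad\<close> is a definite description, so its use rests on existence and
  uniqueness. The gradient is the Riesz vector of the derivative, read off on \<open>Basis\<close>;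
  uniqueness is inherited from the derivative.\<close>

lemma GDERIV_grad:
  fixes h :: "real ^ 'd \<Rightarrow> real"
  assumes "h differentiable (at w)"
  shows "GDERIV h w :> grad h w"
proof -
  obtain h' where h': "(h has_derivative h') (at w)"
    using assms by (auto simp: differentiable_def)
  then interpret bounded_linear h' by (rule has_derivative_bounded_linear)
  define g where "g = (\<Sum>b\<in>Basis. h' b *\<^sub>R b)"
  have "h' x = inner x g" for x
  proof -
    have "h' x = h' (\<Sum>b\<in>Basis. inner x b *\<^sub>R b)"
      by (simp add: euclidean_representation)
    then show ?thesis
      by (simp add: sum scaleR g_def inner_sum_right mult.commute)
  qed
  then have "h' = (\<lambda>x. inner x g)"
    by (rule ext)
  then have g: "GDERIV h w :> g"
    using h' by (simp add: gderiv_def)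
  moreover have "g' = g" if "GDERIV h w :> g'" for g'
  proof -
    have "(\<lambda>x. inner x g') = (\<lambda>x. inner x g)"
      using that g unfolding gderiv_def by (rule has_derivative_unique)
    then show ?thesis
      by (metis vector_eq_rdot inner_commute)
  qed
  ultimately show ?thesis
    unfolding grad_def by (metis theI)
qed

lemma DERIV_along_line:
  fixes h :: "real ^ 'd \<Rightarrow> real"
  assumes "\<And>w. h differentiable (at w)"
  shows "((\<lambda>t. h (x + t *\<^sub>R d)) has_field_derivative inner (grad h (x + t *\<^sub>R d)) d) (at t)"
proof -
  have "(h has_derivative (\<lambda>y. inner y (grad h (x + t *\<^sub>R d)))) (at (x + t *\<^sub>R d))"
    using GDERIV_grad[OF assms] by (simp add: gderiv_def)
  moreover have "((\<lambda>t. x + t *\<^sub>R d) has_derivative (\<lambda>s. s *\<^sub>R d)) (at t)"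
    by (auto intro!: derivative_eq_intros)
  ultimately have "((\<lambda>t. h (x + t *\<^sub>R d)) has_derivative
      (\<lambda>s. inner (s *\<^sub>R d) (grad h (x + t *\<^sub>R d)))) (at t)"
    using has_derivative_compose by blast
  then show ?thesis
    by (simp add: has_field_derivative_def inner_commute mult.commute[of _ "inner _ _"])
qed

text \<open>The descent lemma. On the segment from \<open>x\<close> to \<open>y\<close>,
  Cauchy-Schwarz and the Lipschitz bound limit the growth of the directional derivative to a linear
  rate.\<close>

lemma lipschitz_grad_upper_bound:
  fixes h :: "real ^ 'd \<Rightarrow> real"
  assumes diff: "\<And>w. h differentiable (at w)"
    and lip: "\<And>w w'. norm (grad h w - grad h w') \<le> L * norm (w - w')"
  shows "h y \<le> h x + inner (grad h x) (y - x) + L / 2 * (norm (y - x))\<^sup>2"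
proof -
  define d where "d = y - x"
  \<comment> \<open>The difference between \<open>h\<close> and its quadratic model along the
    segment, up to the constant \<open>h x\<close>; \<open>\<phi> 1 \<le> \<phi> 0\<close> is the
    claim.\<close>
  define \<phi> where "\<phi> t = h (x + t *\<^sub>R d) - t * inner (grad h x) d - L / 2 * (norm d)\<^sup>2 * t\<^sup>2" for t :: real
  have "\<phi> 0 \<ge> \<phi> 1"
  proof (rule DERIV_nonpos_imp_nonincreasing[where f = \<phi>])
    fix t :: real
    assume t: "0 \<le> t" "t \<le> 1"
    have "(\<phi> has_field_derivative
        (inner (grad h (x + t *\<^sub>R d)) d - inner (grad h x) d - L * (norm d)\<^sup>2 * t)) (at t)"
      unfolding \<phi>_def
      by (auto intro!: derivative_eq_intros DERIV_along_line[OF diff])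
    moreover have "inner (grad h (x + t *\<^sub>R d)) d - inner (grad h x) d \<le> L * (norm d)\<^sup>2 * t"
    proof -
      have "inner (grad h (x + t *\<^sub>R d)) d - inner (grad h x) d
          = inner (grad h (x + t *\<^sub>R d) - grad h x) d"
        by (simp add: inner_diff_left)
      also have "\<dots> \<le> norm (grad h (x + t *\<^sub>R d) - grad h x) * norm d"
        by (rule norm_cauchy_schwarz)
      also have "\<dots> \<le> (L * norm (x + t *\<^sub>R d - x)) * norm d"
        by (intro mult_right_mono lip) auto
      finally show ?thesis
        using t by (simp add: power2_eq_square mult_ac)
    qed
    ultimately show "\<exists>y. DERIV \<phi> t :> y \<and> y \<le> 0"
      by (intro exI[of _ "inner (grad h (x + t *\<^sub>R d)) d - inner (grad h x) d - L * (norm d)\<^sup>2 * t"]) auto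
  qed simp
  then show ?thesis
    by (simp add: \<phi>_def d_def)
qed

text \<open>Restriction to the line through \<open>x\<close> and \<open>y\<close> reduces this to
  the tangent inequality in one variable, taken at parameter 0.\<close>

lemma convex_on_imp_above_gradient:
  fixes h :: "real ^ 'd \<Rightarrow> real"
  assumes diff: "\<And>w. h differentiable (at w)" and convex: "convex_on UNIV h"
  shows "h y \<ge> h x + inner (grad h x) (y - x)"
proof -
  have "convex_on UNIV (\<lambda>t::real. h (x + t *\<^sub>R (y - x)))"
  proof (rule convex_onI)
    fix t a b :: real
    assume "0 < t" "t < 1"
    have eq: "x + ((1 - t) *\<^sub>R a + t *\<^sub>R b) *\<^sub>R (y - x)
        = (1 - t) *\<^sub>R (x + a *\<^sub>R (y - x)) + t *\<^sub>R (x + b *\<^sub>R (y - x))"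
      by (simp add: algebra_simps)
    show "h (x + ((1 - t) *\<^sub>R a + t *\<^sub>R b) *\<^sub>R (y - x))
        \<le> (1 - t) * h (x + a *\<^sub>R (y - x)) + t * h (x + b *\<^sub>R (y - x))"
      unfolding eq using \<open>0 < t\<close> \<open>t < 1\<close> by (intro convex_onD[OF convex]) auto
  qed simp
  then have "h (x + 1 *\<^sub>R (y - x)) - h (x + 0 *\<^sub>R (y - x))
      \<ge> inner (grad h (x + 0 *\<^sub>R (y - x))) (y - x) * (1 - 0)"
    using DERIV_along_line[OF diff, of x "y - x" 0]
    by (intro convex_on_imp_above_tangent[where A = UNIV]) auto
  then show ?thesis
    by simp
qed

text \<open>Compare the tangent at \<open>x\<close> with the quadratic upper bound at \<open>y\<close>, both evaluated at
  the point \<open>y - (grad h y - grad h x) / L\<close>.\<close>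

lemma convex_lipschitz_grad_bregman:
  fixes h :: "real ^ 'd \<Rightarrow> real"
  assumes diff: "\<And>w. h differentiable (at w)" and convex: "convex_on UNIV h" and "L > 0"
    and lip: "\<And>w w'. norm (grad h w - grad h w') \<le> L * norm (w - w')"
  shows "(norm (grad h y - grad h x))\<^sup>2 \<le> 2 * L * (h y - h x - inner (grad h x) (y - x))"
proof -
  define d where "d = grad h y - grad h x"
  define u where "u = y - (1 / L) *\<^sub>R d"
  have "h x + inner (grad h x) (u - x) \<le> h u"
    by (rule convex_on_imp_above_gradient[OF diff convex])
  also have "\<dots> \<le> h y + inner (grad h y) (u - y) + L / 2 * (norm (u - y))\<^sup>2"
    by (rule lipschitz_grad_upper_bound[OF diff lip])
  finally have "h x + inner (grad h x) (u - x) \<le> \<dots>" .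
  moreover have "inner (grad h x) (u - x) = inner (grad h x) (y - x) - inner (grad h x) d / L"
    and "inner (grad h y) (u - y) = - (inner (grad h y) d / L)" and "u - y = - ((1 / L) *\<^sub>R d)"
    by (simp_all add: u_def inner_diff_right)
  moreover have "inner d d / L = inner (grad h y) d / L - inner (grad h x) d / L"
    by (simp add: d_def inner_diff_left diff_divide_distrib)
  ultimately have "h x + inner (grad h x) (y - x) \<le> h y - inner d d / L + L / 2 * (norm ((1 / L) *\<^sub>R d))\<^sup>2"
    by simp
  also have "L / 2 * (norm ((1 / L) *\<^sub>R d))\<^sup>2 = inner d d / (2 * L)"
    unfolding power2_norm_eq_inner using \<open>L > 0\<close> by (simp add: field_simps)
  finally have "inner d d / (2 * L) \<le> h y - h x - inner (grad h x) (y - x)"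
    using \<open>L > 0\<close> by (simp add: field_simps)
  then show ?thesis
    using \<open>L > 0\<close> unfolding d_def[symmetric] power2_norm_eq_inner by (simp add: field_simps)
qed

text \<open>Adding the previous bound for both orders of the pair cancels the function values and
  leaves only the inner product.\<close>

lemma convex_lipschitz_grad_cocoercive:
  fixes h :: "real ^ 'd \<Rightarrow> real"
  assumes "\<And>w. h differentiable (at w)" and "convex_on UNIV h" and "L > 0"
    and "\<And>w w'. norm (grad h w - grad h w') \<le> L * norm (w - w')"
  shows "(norm (grad h y - grad h x))\<^sup>2 \<le> L * inner (grad h y - grad h x) (y - x)"
proof -
  have "(norm (grad h y - grad h x))\<^sup>2 \<le> 2 * L * (h y - h x - inner (grad h x) (y - x))"
    by (rule convex_lipschitz_grad_bregman[OF assms])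
  moreover have "(norm (grad h x - grad h y))\<^sup>2 \<le> 2 * L * (h x - h y - inner (grad h y) (x - y))"
    by (rule convex_lipschitz_grad_bregman[OF assms])
  ultimately show ?thesis
    by (simp add: norm_minus_commute inner_diff_left inner_diff_right algebra_simps)
qed

text \<open>A gradient step with step size \<open>1 / L\<close> lowers \<open>h\<close> by at least
  \<open>(norm (grad h x))\<^sup>2 / (2 * L)\<close>, and the value reached is still at least
  \<open>c\<close>.\<close>

lemma lipschitz_grad_norm_le:
  fixes h :: "real ^ 'd \<Rightarrow> real"
  assumes diff: "\<And>w. h differentiable (at w)" and "L > 0"
    and lip: "\<And>w w'. norm (grad h w - grad h w') \<le> L * norm (w - w')"
    and lower: "\<And>w. c \<le> h w"
  shows "(norm (grad h x))\<^sup>2 \<le> 2 * L * (h x - c)"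
proof -
  define y where "y = x - (1 / L) *\<^sub>R grad h x"
  have "c \<le> h x + inner (grad h x) (y - x) + L / 2 * (norm (y - x))\<^sup>2"
    using lower lipschitz_grad_upper_bound[OF diff lip] order_trans by blast
  moreover have "inner (grad h x) (y - x) = - ((norm (grad h x))\<^sup>2 / L)"
    by (simp add: y_def power2_norm_eq_inner)
  moreover have "L / 2 * (norm (y - x))\<^sup>2 = 1 / 2 * ((norm (grad h x))\<^sup>2 / L)"
    using \<open>L > 0\<close> by (simp add: y_def power_divide) (simp add: power2_eq_square)
  ultimately have "(norm (grad h x))\<^sup>2 / L \<le> 2 * (h x - c)"
    by argo
  then show ?thesis
    using \<open>L > 0\<close> by (simp add: field_simps)
qed

section \<open>Measurability and independence\<close>

text \<open>Approximate the first argument by simple functions.\<close>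

lemma borel_measurable_caratheodory:
  fixes g :: "'a :: {metric_space, second_countable_topology} \<Rightarrow> 'z \<Rightarrow> 'c :: metric_space"
  assumes cont: "\<And>z. z \<in> space D \<Longrightarrow> continuous_on UNIV (\<lambda>w. g w z)"
    and meas: "\<And>w. g w \<in> borel_measurable D"
  shows "(\<lambda>(w, z). g w z) \<in> borel_measurable (borel \<Otimes>\<^sub>M D)"
proof -
  obtain s :: "nat \<Rightarrow> 'a \<Rightarrow> 'a" where s: "\<And>i. simple_function borel (s i)" "\<And>x. (\<lambda>i. s i x) \<longlonglongrightarrow> x"
    using borel_measurable_implies_sequence_metric[of "\<lambda>x::'a. x" borel undefined] by auto
  show ?thesis
  proof (rule borel_measurable_LIMSEQ_metric)
    fix i
    have fin: "countable (range (s i))"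
      using simple_functionD(1)[OF s(1), of i] by (simp add: countable_finite)
    have si: "s i \<in> measurable borel (count_space (range (s i)))"
      using s(1)[of i] by (auto simp: simple_function_def measurable_count_space_eq2)
    have "(\<lambda>p. g (s i (fst p)) (snd p)) \<in> borel_measurable (borel \<Otimes>\<^sub>M D)"
      by (rule measurable_compose_countable'[where f = "\<lambda>w p. g w (snd p)", OF _ _ fin])
         (use si meas in \<open>auto intro: measurable_compose[OF measurable_snd] measurable_compose[OF measurable_fst]\<close>)
    then show "(\<lambda>(w, z). g (s i w) z) \<in> borel_measurable (borel \<Otimes>\<^sub>M D)"
      by (simp add: case_prod_beta')
  next
    fix p :: "'a \<times> 'z"
    assume "p \<in> space (borel \<Otimes>\<^sub>M D)"
    then obtain w z where p: "p = (w, z)" "z \<in> space D"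
      by (auto simp: space_pair_measure)
    have "(\<lambda>i. g (s i w) z) \<longlonglongrightarrow> g w z"
      using cont[OF p(2)] s(2)[of w] by (auto simp: continuous_on_eq_continuous_at intro: isCont_tendsto_compose[where g = "\<lambda>w. g w z"])
    then show "(\<lambda>i. case p of (w, z) \<Rightarrow> g (s i w) z) \<longlonglongrightarrow> (case p of (w, z) \<Rightarrow> g w z)"
      by (simp add: p)
  qed
qed

text \<open>This takes the place of conditioning on \<open>Y\<close>: since the joint law is a
  product, Fubini integrates out \<open>Z\<close> for fixed \<open>Y\<close>, and the factor
  depending on \<open>Y\<close> alone leaves the inner integral.\<close>

lemma (in prob_space) integral_inner_indep:
  fixes u :: "'b \<Rightarrow> 'e :: euclidean_space"
  assumes D: "prob_space D"
    and Y[measurable]: "Y \<in> measurable M N" and Z[measurable]: "Z \<in> measurable M D"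
    and distr: "distr M (N \<Otimes>\<^sub>M D) (\<lambda>\<omega>. (Y \<omega>, Z \<omega>)) = distr M N Y \<Otimes>\<^sub>M D"
    and u[measurable]: "u \<in> borel_measurable N"
    and h[measurable]: "h \<in> borel_measurable (N \<Otimes>\<^sub>M D)"
    and hint: "\<And>y. y \<in> space N \<Longrightarrow> integrable D (\<lambda>z. h (y, z))"
    and int: "integrable M (\<lambda>\<omega>. inner (u (Y \<omega>)) (h (Y \<omega>, Z \<omega>)))"
  shows "(\<integral>\<omega>. inner (u (Y \<omega>)) (h (Y \<omega>, Z \<omega>)) \<partial>M) = (\<integral>\<omega>. inner (u (Y \<omega>)) (\<integral>z. h (Y \<omega>, z) \<partial>D) \<partial>M)"
proof -
  interpret Y: prob_space "distr M N Y" by (rule prob_space_distr) measurable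
  interpret D: prob_space D by fact
  interpret P: pair_sigma_finite "distr M N Y" D ..
  let ?k = "\<lambda>p. inner (u (fst p)) (h p)"
  have [measurable]: "?k \<in> borel_measurable (N \<Otimes>\<^sub>M D)"
    by measurable
  have "integrable (distr M N Y \<Otimes>\<^sub>M D) ?k"
    unfolding distr[symmetric] using int by (subst integrable_distr_eq) auto
  have "(\<integral>\<omega>. inner (u (Y \<omega>)) (h (Y \<omega>, Z \<omega>)) \<partial>M) = (\<integral>p. ?k p \<partial>(distr M N Y \<Otimes>\<^sub>M D))"
    unfolding distr[symmetric] by (subst integral_distr) auto
  also have "\<dots> = (\<integral>y. (\<integral>z. ?k (y, z) \<partial>D) \<partial>distr M N Y)"
    by (rule P.integral_fst'[symmetric]) fact
  also have "\<dots> = (\<integral>\<omega>. (\<integral>z. ?k (Y \<omega>, z) \<partial>D) \<partial>M)"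
    by (rule integral_distr) measurable
  also have "\<dots> = (\<integral>\<omega>. inner (u (Y \<omega>)) (\<integral>z. h (Y \<omega>, z) \<partial>D) \<partial>M)"
    using measurable_space[OF Y] hint by (intro Bochner_Integration.integral_cong) auto
  finally show ?thesis .
qed

text \<open>The definition \<open>isarah_samples\<close> speaks of independent sigma-algebras; this
  passes to random variables. The sigma-algebra generated by a variable measurable in
  \<open>A\<close> or \<open>B\<close> lies inside it, and independence descends to
  subfamilies.\<close>

lemma (in prob_space) indep_var_of_indep_set:
  assumes indep: "indep_set (sets A) (sets B)" and "space A = space M" "space B = space M"
    and Y: "Y \<in> measurable A S" and Z: "Z \<in> measurable B T"
  shows "indep_var S Y T Z"
proof -
  have ev: "sets A \<subseteq> events" "sets B \<subseteq> events"
    using indep by (auto dest: indep_setD_ev1 indep_setD_ev2)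
  have sub: "sigma_sets (space M) {f -` E \<inter> space M | E. E \<in> sets N} \<subseteq> sets C"
    if "f \<in> measurable C N" "space C = space M" for f N and C :: "'a measure"
    using measurable_sets[OF that(1)] that(2)
    by (intro sets.sigma_sets_subset[of _ C, unfolded that(2)]) auto
  have "Y \<in> measurable M S" "Z \<in> measurable M T"
    using Y Z ev assms(2,3) by (auto simp: measurable_def)
  moreover have "indep_set (sigma_sets (space M) {Y -` E \<inter> space M | E. E \<in> sets S})
      (sigma_sets (space M) {Z -` E \<inter> space M | E. E \<in> sets T})"
    using indep unfolding indep_set_def
    by (rule indep_sets_mono_sets) (use sub[OF Y assms(2)] sub[OF Z assms(3)] in \<open>auto split: bool.split\<close>)
  ultimately show ?thesis
    by (simp add: indep_var_eq)
qed

lemma integrable_inner_of_square_integrable: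
  fixes u v :: "'a \<Rightarrow> 'e :: euclidean_space"
  assumes [measurable]: "u \<in> borel_measurable M" "v \<in> borel_measurable M"
    and "integrable M (\<lambda>\<omega>. (norm (u \<omega>))\<^sup>2)" "integrable M (\<lambda>\<omega>. (norm (v \<omega>))\<^sup>2)"
  shows "integrable M (\<lambda>\<omega>. inner (u \<omega>) (v \<omega>))"
proof (rule Bochner_Integration.integrable_bound[where f = "\<lambda>\<omega>. (norm (u \<omega>))\<^sup>2 + (norm (v \<omega>))\<^sup>2"])
  show "AE \<omega> in M. norm (inner (u \<omega>) (v \<omega>)) \<le> norm ((norm (u \<omega>))\<^sup>2 + (norm (v \<omega>))\<^sup>2)"
  proof (rule AE_I2)
    fix \<omega>
    have "\<bar>inner (u \<omega>) (v \<omega>)\<bar> \<le> norm (u \<omega>) * norm (v \<omega>)"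
      by (rule Cauchy_Schwarz_ineq2)
    also have "\<dots> \<le> (norm (u \<omega>))\<^sup>2 + (norm (v \<omega>))\<^sup>2"
      using sum_squares_bound[of "norm (u \<omega>)" "norm (v \<omega>)"] mult_nonneg_nonneg[OF norm_ge_zero norm_ge_zero, of "u \<omega>" "v \<omega>"]
      by linarith
    finally show "norm (inner (u \<omega>) (v \<omega>)) \<le> norm ((norm (u \<omega>))\<^sup>2 + (norm (v \<omega>))\<^sup>2)"
      by simp
  qed
qed (use assms in auto)

section \<open>The stochastic objective\<close>

locale smooth_convex_objective =
  fixes D :: "'z measure" and f :: "real ^ 'd \<Rightarrow> 'z \<Rightarrow> real" and L \<sigma> :: real and wstar :: "real ^ 'd"
  assumes objective: "stochastic_objective D f"
    and convex: "\<forall>z\<in>space D. convex_on UNIV (\<lambda>w. f w z)"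
    and L_pos: "L > 0"
    and smooth: "smooth_realizations D f L"
    and minimizer: "\<forall>w. expected_loss D f wstar \<le> expected_loss D f w"
    and sigma_int: "integrable D (\<lambda>z. (norm (stoch_grad f wstar z))\<^sup>2)"
    and sigma_bound: "(\<integral>z. (norm (stoch_grad f wstar z))\<^sup>2 \<partial>D) \<le> \<sigma>\<^sup>2"
begin

abbreviation g :: "real ^ 'd \<Rightarrow> 'z \<Rightarrow> real ^ 'd" where "g \<equiv> stoch_grad f"
abbreviation F :: "real ^ 'd \<Rightarrow> real" where "F \<equiv> expected_loss D f"
abbreviation G :: "real ^ 'd \<Rightarrow> real ^ 'd" where "G \<equiv> grad F"

sublocale D: prob_space D
  using objective by (simp add: stochastic_objective_def)

lemma f_differentiable: "z \<in> space D \<Longrightarrow> (\<lambda>u. f u z) differentiable (at w)"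
  and F_differentiable: "F differentiable (at w)"
  and g_integrable: "integrable D (g w)"
  and integral_g: "(\<integral>z. g w z \<partial>D) = G w"
  and f_integrable: "integrable D (f w)"
  using objective by (simp_all add: stochastic_objective_def)

lemma g_lipschitz: "z \<in> space D \<Longrightarrow> norm (g w z - g w' z) \<le> L * norm (w - w')"
  using smooth by (simp add: smooth_realizations_def)

lemma g_measurable [measurable]: "g w \<in> borel_measurable D"
  using g_integrable by (rule borel_measurable_integrable)

text \<open>The sampled gradient is evaluated at random iterates, so measurability for each fixed
  point is too weak. Lipschitz continuity in the point gives the Caratheodory condition.\<close>

lemma g_jointly_measurable: "(\<lambda>(w, z). g w z) \<in> borel_measurable (borel \<Otimes>\<^sub>M D)"
proof (rule borel_measurable_caratheodory)
  fix z assume z: "z \<in> space D"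
  show "continuous_on UNIV (\<lambda>w. g w z)"
    using L_pos g_lipschitz[OF z]
    by (intro lipschitz_on_continuous_on[of L] lipschitz_onI) (auto simp: dist_norm)
qed simp

lemma g_compose_measurable [measurable (raw)]:
  assumes [measurable]: "a \<in> borel_measurable N" "Z \<in> measurable N D"
  shows "(\<lambda>y. g (a y) (Z y)) \<in> borel_measurable N"
  using measurable_compose[OF _ g_jointly_measurable, of "\<lambda>y. (a y, Z y)" N] by simp

text \<open>The constant \<open>L\<close> survives averaging because the norm of a mean is at most
  the mean of the norm.\<close>

lemma G_lipschitz: "norm (G w - G w') \<le> L * norm (w - w')"
proof -
  have "norm (G w - G w') = norm (\<integral>z. g w z - g w' z \<partial>D)"
    by (simp add: integral_g g_integrable)
  also have "\<dots> \<le> (\<integral>z. norm (g w z - g w' z) \<partial>D)"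
    by (rule integral_norm_bound)
  also have "\<dots> \<le> (\<integral>z. L * norm (w - w') \<partial>D)"
    by (intro integral_mono) (auto simp: g_integrable g_lipschitz)
  finally show ?thesis
    by (simp add: D.prob_space)
qed

lemma G_measurable [measurable]: "G \<in> borel_measurable borel"
  using L_pos G_lipschitz
  by (intro borel_measurable_continuous_onI lipschitz_on_continuous_on[of L] lipschitz_onI)
     (auto simp: dist_norm)

lemma g_cocoercive:
  assumes "z \<in> space D"
  shows "(norm (g w z - g w' z))\<^sup>2 \<le> L * inner (g w z - g w' z) (w - w')"
  using convex_lipschitz_grad_cocoercive[of "\<lambda>u. f u z" L w w'] f_differentiable[OF assms]
    convex L_pos g_lipschitz[OF assms] assms by (simp add: stoch_grad_def)

lemma g_bregman:
  assumes "z \<in> space D"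
  shows "(norm (g w z - g w' z))\<^sup>2 \<le> 2 * L * (f w z - f w' z - inner (g w' z) (w - w'))"
  using convex_lipschitz_grad_bregman[of "\<lambda>u. f u z" L w w'] f_differentiable[OF assms]
    convex L_pos g_lipschitz[OF assms] assms by (simp add: stoch_grad_def)

lemma G_minimizer: "G wstar = 0"
  using lipschitz_grad_norm_le[of F L "F wstar" wstar] F_differentiable L_pos G_lipschitz minimizer
  by simp

text \<open>Each realization is compared with its own gradient at \<open>wstar\<close>: the
  difference is controlled by the Bregman bound, the rest by \<open>\<sigma>\<close>.\<close>

lemma second_moment_g:
  shows integrable_norm2_g: "integrable D (\<lambda>z. (norm (g w z))\<^sup>2)"
    and integral_norm2_g_le: "(\<integral>z. (norm (g w z))\<^sup>2 \<partial>D) \<le> 4 * L * (F w - F wstar) + 2 * \<sigma>\<^sup>2"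
proof -
  let ?B = "\<lambda>z. 2 * (norm (g wstar z))\<^sup>2
    + 4 * L * (f w z - f wstar z - inner (g wstar z) (w - wstar))"
  have le: "(norm (g w z))\<^sup>2 \<le> ?B z" if "z \<in> space D" for z
  proof -
    have "(norm (g w z))\<^sup>2 \<le> (norm (g wstar z) + norm (g w z - g wstar z))\<^sup>2"
      by (intro power_mono norm_triangle_sub) auto
    also have "\<dots> \<le> 2 * (norm (g wstar z))\<^sup>2 + 2 * (norm (g w z - g wstar z))\<^sup>2"
      using sum_squares_bound[of "norm (g wstar z)" "norm (g w z - g wstar z)"]
      by (simp add: power2_sum)
    finally show ?thesis
      using g_bregman[OF that, of w wstar] by simp
  qed
  have int: "integrable D ?B"
    using sigma_int f_integrable g_integrable by auto
  show "integrable D (\<lambda>z. (norm (g w z))\<^sup>2)"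
    by (rule Bochner_Integration.integrable_bound[OF int]) (auto intro!: AE_I2 order_trans[OF le])
  then have "(\<integral>z. (norm (g w z))\<^sup>2 \<partial>D) \<le> (\<integral>z. ?B z \<partial>D)"
    using int le by (intro integral_mono) auto
  \<comment> \<open>The linear term integrates to an inner product with \<open>G wstar\<close>,
    which is zero; only the gap in \<open>F\<close> is left of the Bregman term.\<close>
  also have "\<dots> = 2 * (\<integral>z. (norm (g wstar z))\<^sup>2 \<partial>D) + 4 * L * (F w - F wstar - inner (G wstar) (w - wstar))"
    using sigma_int f_integrable g_integrable by (simp add: expected_loss_def integral_g)
  also have "\<dots> \<le> 4 * L * (F w - F wstar) + 2 * \<sigma>\<^sup>2"
    using sigma_bound by (simp add: G_minimizer)
  finally show "(\<integral>z. (norm (g w z))\<^sup>2 \<partial>D) \<le> 4 * L * (F w - F wstar) + 2 * \<sigma>\<^sup>2" .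
qed

end

section \<open>One run of the procedure\<close>

locale isarah_run = smooth_convex_objective D f L \<sigma> wstar
  for D :: "'z measure" and f :: "real ^ 'd \<Rightarrow> 'z \<Rightarrow> real" and L \<sigma> :: real and wstar :: "real ^ 'd" +
  fixes w0 :: "real ^ 'd" and \<eta> :: real and m b :: nat and M :: "'p measure"
    and \<zeta> \<xi> :: "nat \<Rightarrow> 'p \<Rightarrow> 'z" and \<tau> :: "'p \<Rightarrow> nat"
  assumes eta_pos: "\<eta> > 0" and L_eta: "L * \<eta> \<le> 1" and b_pos: "b > 0"
    and samples: "isarah_samples D m b M \<zeta> \<xi> \<tau>"
begin

text \<open>The index \<open>Inl i\<close> stands for the batch sample \<open>\<zeta>\<^sub>i\<close>, and \<open>Inr t\<close> for the sample \<open>\<xi>\<^sub>t\<close>. The family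
  \<open>J t\<close> is what determines \<open>v\<^sub>t\<close> and \<open>w\<^sub>t\<^sub>+\<^sub>1\<close>.\<close>

definition X :: "nat + nat \<Rightarrow> 'p \<Rightarrow> 'z" where "X = case_sum \<zeta> \<xi>"
definition I :: "(nat + nat) set" where "I = Inl ` {1..b} \<union> Inr ` {1..}"
definition J :: "nat \<Rightarrow> (nat + nat) set" where "J t = Inl ` {1..b} \<union> Inr ` {1..t}"

text \<open>Upper case is a function of a sample path, living on a product space of samples; lower
  case is the random variable on \<open>M\<close>. The split lets dependence on past samples be
  expressed as measurability on \<open>PiM\<close>.\<close>

abbreviation W :: "nat \<Rightarrow> (nat + nat \<Rightarrow> 'z) \<Rightarrow> real ^ 'd" where
  "W t p \<equiv> isarah_w f w0 \<eta> b (\<lambda>i. p (Inl i)) (\<lambda>i. p (Inr i)) t"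
abbreviation V :: "nat \<Rightarrow> (nat + nat \<Rightarrow> 'z) \<Rightarrow> real ^ 'd" where
  "V t p \<equiv> isarah_v f w0 \<eta> b (\<lambda>i. p (Inl i)) (\<lambda>i. p (Inr i)) t"
abbreviation w :: "nat \<Rightarrow> 'p \<Rightarrow> real ^ 'd" where "w t \<omega> \<equiv> W t (\<lambda>j. X j \<omega>)"
abbreviation v :: "nat \<Rightarrow> 'p \<Rightarrow> real ^ 'd" where "v t \<omega> \<equiv> V t (\<lambda>j. X j \<omega>)"

section \<open>Iterates as measurable functions of finitely many samples\<close>

sublocale M: prob_space M
  using samples by (simp add: isarah_samples_def Let_def)

lemma indep_X: "M.indep_vars (\<lambda>_. D) X I"
  and distr_X: "j \<in> I \<Longrightarrow> distr M D (X j) = D"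
  and tau_measurable [measurable]: "\<tau> \<in> measurable M (count_space UNIV)"
  and indep_tau: "M.indep_set
          (sets (vimage_algebra (space M) \<tau> (count_space UNIV)))
          (sets (vimage_algebra (space M) (\<lambda>\<omega>. \<lambda>j\<in>I. X j \<omega>) (Pi\<^sub>M I (\<lambda>_. D))))"
  and distr_tau: "distr M (count_space UNIV) \<tau> = measure_pmf (pmf_of_set {0..m})"
  using samples by (simp_all add: isarah_samples_def Let_def X_def I_def)

lemma X_measurable: "j \<in> I \<Longrightarrow> X j \<in> measurable M D"
  using indep_X by (auto simp: M.indep_vars_def)

lemma J_subset_I: "J t \<subseteq> I"
  by (auto simp: J_def I_def)

text \<open>The three claims are proved together because a step of the recursion uses both iterates
  and the estimate. The index set \<open>A\<close> stays general so that it can be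
  \<open>J t\<close> for conditioning on the past or \<open>I\<close> for the random index.\<close>

lemma path_measurable:
  assumes "J t \<subseteq> A"
  shows "W t \<in> borel_measurable (PiM A (\<lambda>_. D)) \<and> V t \<in> borel_measurable (PiM A (\<lambda>_. D))
    \<and> W (Suc t) \<in> borel_measurable (PiM A (\<lambda>_. D))"
  using assms
proof (induction t)
  case 0
  have [measurable]: "(\<lambda>p. p (Inl i)) \<in> measurable (PiM A (\<lambda>_. D)) D" if "i \<in> {1..b}" for i
    using 0 that by (intro measurable_component_singleton) (auto simp: J_def)
  show ?case
    by simp
next
  case (Suc t)
  have [measurable]: "(\<lambda>p. p (Inr (Suc t))) \<in> measurable (PiM A (\<lambda>_. D)) D"
    using Suc.prems by (intro measurable_component_singleton) (auto simp: J_def)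
  have "J t \<subseteq> A"
    using Suc.prems by (auto simp: J_def)
  then have [measurable]: "W t \<in> borel_measurable (PiM A (\<lambda>_. D))"
    "V t \<in> borel_measurable (PiM A (\<lambda>_. D))" "W (Suc t) \<in> borel_measurable (PiM A (\<lambda>_. D))"
    using Suc.IH by auto
  have [measurable]: "V (Suc t) \<in> borel_measurable (PiM A (\<lambda>_. D))"
    by (subst isarah_v.simps) (measurable)
  show ?case
    by (subst (2) isarah_w.simps) measurable
qed

lemma path_cong:
  assumes "\<And>j. j \<in> J t \<Longrightarrow> p j = q j"
  shows "W t p = W t q \<and> V t p = V t q \<and> W (Suc t) p = W (Suc t) q"
  using assms
proof (induction t)
  case 0
  then show ?case
    by (simp add: J_def)
next
  case (Suc t)
  have "J t \<subseteq> J (Suc t)"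
    by (auto simp: J_def)
  then have "W t p = W t q \<and> V t p = V t q \<and> W (Suc t) p = W (Suc t) q"
    using Suc.prems by (intro Suc.IH) auto
  moreover have "p (Inr (Suc t)) = q (Inr (Suc t))"
    using Suc.prems by (auto simp: J_def)
  ultimately show ?case
    by simp
qed

text \<open>Points of \<open>PiM A\<close> are undefined outside \<open>A\<close>, so random paths
  enter it as restrictions; this removes the restriction again.\<close>

lemma path_restrict:
  assumes "J t \<subseteq> A"
  shows "W t (restrict p A) = W t p" "V t (restrict p A) = V t p"
    "W (Suc t) (restrict p A) = W (Suc t) p"
proof -
  have "restrict p A j = p j" if "j \<in> J t" for j
    using that assms by auto
  from path_cong[of t "restrict p A" p, OF this]
  show "W t (restrict p A) = W t p" "V t (restrict p A) = V t p" "W (Suc t) (restrict p A) = W (Suc t) p"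
    by blast+
qed

lemma samples_measurable:
  assumes "A \<subseteq> I"
  shows "(\<lambda>\<omega>. \<lambda>j\<in>A. X j \<omega>) \<in> measurable M (PiM A (\<lambda>_. D))"
  using assms by (intro measurable_restrict X_measurable) auto

lemma w_measurable [measurable]: "w t \<in> borel_measurable M"
  and v_measurable [measurable]: "v t \<in> borel_measurable M"
proof -
  have "W t \<in> borel_measurable (PiM (J t) (\<lambda>_. D))" "V t \<in> borel_measurable (PiM (J t) (\<lambda>_. D))"
    using path_measurable[of t "J t"] by auto
  from this[THEN measurable_compose[OF samples_measurable[OF J_subset_I]]]
  show "w t \<in> borel_measurable M" "v t \<in> borel_measurable M"
    by (simp_all only: path_restrict[OF order_refl])
qed

lemma norm_g_X:
  assumes "j \<in> I"
  shows "integrable M (\<lambda>\<omega>. (norm (g u (X j \<omega>)))\<^sup>2)"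
    and "(\<integral>\<omega>. (norm (g u (X j \<omega>)))\<^sup>2 \<partial>M) = (\<integral>z. (norm (g u z))\<^sup>2 \<partial>D)"
proof -
  note [measurable] = X_measurable[OF assms]
  have "integrable (distr M D (X j)) (\<lambda>z. (norm (g u z))\<^sup>2)"
    using distr_X[OF assms] integrable_norm2_g by simp
  then show "integrable M (\<lambda>\<omega>. (norm (g u (X j \<omega>)))\<^sup>2)"
    by (subst (asm) integrable_distr_eq) auto
  have "(\<integral>z. (norm (g u z))\<^sup>2 \<partial>distr M D (X j)) = (\<integral>\<omega>. (norm (g u (X j \<omega>)))\<^sup>2 \<partial>M)"
    by (rule integral_distr) measurable
  then show "(\<integral>\<omega>. (norm (g u (X j \<omega>)))\<^sup>2 \<partial>M) = (\<integral>z. (norm (g u z))\<^sup>2 \<partial>D)"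
    using distr_X[OF assms] by simp
qed

section \<open>Integrating out a fresh sample\<close>

declare isarah_w.simps [simp del] isarah_v.simps [simp del]

lemma distr_samples_Pair:
  assumes "A \<subseteq> I" "j \<in> I" "j \<notin> A"
  shows "distr M (PiM A (\<lambda>_. D) \<Otimes>\<^sub>M D) (\<lambda>\<omega>. (\<lambda>i\<in>A. X i \<omega>, X j \<omega>))
    = distr M (PiM A (\<lambda>_. D)) (\<lambda>\<omega>. \<lambda>i\<in>A. X i \<omega>) \<Otimes>\<^sub>M D"
proof -
  \<comment> \<open>Independence of subfamilies is a statement about restricted families, so sample
    \<open>j\<close> first appears as a family over \<open>{j}\<close> and is then mapped to its
    only component.\<close>
  let ?N = "PiM A (\<lambda>_. D)" and ?S = "PiM {j} (\<lambda>_. D)"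
  let ?Y = "\<lambda>\<omega>. \<lambda>i\<in>A. X i \<omega>" and ?Z = "\<lambda>\<omega>. \<lambda>i\<in>{j}. X i \<omega>"
  have [measurable]: "?Y \<in> measurable M ?N" "?Z \<in> measurable M ?S"
    using assms by (intro samples_measurable; auto)+
  have [measurable]: "(\<lambda>p. p j) \<in> measurable ?S D"
    by (rule measurable_component_singleton) simp
  have ind: "distr M ?N ?Y \<Otimes>\<^sub>M distr M ?S ?Z = distr M (?N \<Otimes>\<^sub>M ?S) (\<lambda>\<omega>. (?Y \<omega>, ?Z \<omega>))"
    using M.indep_var_restrict[OF indep_X, of A "{j}"] assms
    by (simp add: M.indep_var_distribution_eq)
  have Z: "distr (distr M ?S ?Z) D (\<lambda>p. p j) = D"
    using distr_X[OF assms(2)] by (simp add: distr_distr comp_def)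
  have "distr M (?N \<Otimes>\<^sub>M D) (\<lambda>\<omega>. (?Y \<omega>, X j \<omega>))
      = distr (distr M (?N \<Otimes>\<^sub>M ?S) (\<lambda>\<omega>. (?Y \<omega>, ?Z \<omega>))) (?N \<Otimes>\<^sub>M D) (\<lambda>(y, p). (y, p j))"
    by (subst distr_distr) (auto simp: comp_def)
  also have "\<dots> = distr (distr M ?N ?Y \<Otimes>\<^sub>M distr M ?S ?Z) (?N \<Otimes>\<^sub>M D) (\<lambda>(y, p). (y, p j))"
    by (simp only: ind)
  also have "\<dots> = distr (distr M ?N ?Y) ?N (\<lambda>y. y) \<Otimes>\<^sub>M distr (distr M ?S ?Z) D (\<lambda>p. p j)"
    by (rule pair_measure_distr[symmetric])
       (auto simp: Z intro: D.sigma_finite_measure_axioms)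
  also have "\<dots> = distr M ?N ?Y \<Otimes>\<^sub>M D"
    unfolding Z by (simp add: distr_distr comp_def)
  finally show ?thesis .
qed

text \<open>The counterpart of a conditional expectation given the samples in \<open>A\<close>: the
  fresh sample \<open>j\<close> is averaged while those in \<open>A\<close> are kept.\<close>

lemma integral_inner_samples:
  fixes u :: "(nat + nat \<Rightarrow> 'z) \<Rightarrow> real ^ 'd"
  assumes "A \<subseteq> I" "j \<in> I" "j \<notin> A"
    and "u \<in> borel_measurable (PiM A (\<lambda>_. D))"
    and "h \<in> borel_measurable (PiM A (\<lambda>_. D) \<Otimes>\<^sub>M D)"
    and "\<And>p. p \<in> space (PiM A (\<lambda>_. D)) \<Longrightarrow> integrable D (\<lambda>z. h (p, z))"
    and "integrable M (\<lambda>\<omega>. inner (u (\<lambda>i\<in>A. X i \<omega>)) (h (\<lambda>i\<in>A. X i \<omega>, X j \<omega>)))"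
  shows "(\<integral>\<omega>. inner (u (\<lambda>i\<in>A. X i \<omega>)) (h (\<lambda>i\<in>A. X i \<omega>, X j \<omega>)) \<partial>M)
    = (\<integral>\<omega>. inner (u (\<lambda>i\<in>A. X i \<omega>)) (\<integral>z. h (\<lambda>i\<in>A. X i \<omega>, z) \<partial>D) \<partial>M)"
  using M.integral_inner_indep[OF D.prob_space_axioms samples_measurable X_measurable
      distr_samples_Pair, of A j u h] assms by blast

section \<open>The initial batch gradient\<close>

text \<open>The variance of a mean of \<open>b\<close> independent centred terms: the double sum of
  inner products keeps only its diagonal.\<close>

lemma integral_norm2_v0_diff_le:
  "(\<integral>\<omega>. (norm (v 0 \<omega> - G w0))\<^sup>2 \<partial>M) \<le> (\<integral>z. (norm (g w0 z))\<^sup>2 \<partial>D) / b"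
proof -
  let ?Q = "\<integral>z. (norm (g w0 z))\<^sup>2 \<partial>D"
  define k where "k i \<omega> = g w0 (X (Inl i) \<omega>) - G w0" for i \<omega>
  have I: "Inl i \<in> I" if "i \<in> {1..b}" for i
    using that by (simp add: I_def)
  have k_meas: "k i \<in> borel_measurable M" if "i \<in> {1..b}" for i
    unfolding k_def using X_measurable[OF I[OF that]] by measurable
  have g_int: "integrable M (\<lambda>\<omega>. g w0 (X (Inl i) \<omega>))" and g_mean: "(\<integral>\<omega>. g w0 (X (Inl i) \<omega>) \<partial>M) = G w0"
    if "i \<in> {1..b}" for i
  proof -
    note [measurable] = X_measurable[OF I[OF that]]
    show "integrable M (\<lambda>\<omega>. g w0 (X (Inl i) \<omega>))"
      using g_integrable[of w0] distr_X[OF I[OF that]]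
        integrable_distr_eq[of "X (Inl i)" M D "g w0"] by simp
    show "(\<integral>\<omega>. g w0 (X (Inl i) \<omega>) \<partial>M) = G w0"
      using integral_distr[of "X (Inl i)" M D "g w0"] distr_X[OF I[OF that]] integral_g by simp
  qed
  have k_sq: "(norm (k i \<omega>))\<^sup>2 = (norm (g w0 (X (Inl i) \<omega>)))\<^sup>2
      - 2 * inner (g w0 (X (Inl i) \<omega>)) (G w0) + (norm (G w0))\<^sup>2" for i \<omega>
    by (simp add: k_def power2_norm_eq_inner inner_diff_left inner_diff_right inner_commute)
  \<comment> \<open>Integrating \<open>k_sq\<close> gives the second moment minus
    \<open>(norm (G w0))\<^sup>2\<close>, hence at most \<open>?Q\<close>.\<close>
  have k_int: "integrable M (\<lambda>\<omega>. (norm (k i \<omega>))\<^sup>2)"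
    and k_le: "(\<integral>\<omega>. (norm (k i \<omega>))\<^sup>2 \<partial>M) \<le> ?Q" if "i \<in> {1..b}" for i
    unfolding k_sq using g_int[OF that] norm_g_X[OF I[OF that]]
    by (auto simp: g_mean[OF that] M.prob_space power2_norm_eq_inner)
  have kk_int: "integrable M (\<lambda>\<omega>. inner (k i \<omega>) (k j \<omega>))" if "i \<in> {1..b}" "j \<in> {1..b}" for i j
    using that by (intro integrable_inner_of_square_integrable k_meas k_int)
  have kk: "(\<integral>\<omega>. inner (k i \<omega>) (k j \<omega>) \<partial>M) = 0" if ij: "i \<in> {1..b}" "j \<in> {1..b}" "i \<noteq> j" for i j
  proof -
    have "(\<integral>\<omega>. inner (k i \<omega>) (k j \<omega>) \<partial>M)
        = (\<integral>\<omega>. inner (k i \<omega>) (\<integral>z. g w0 z - G w0 \<partial>D) \<partial>M)"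
      using integral_inner_samples[of "{Inl i}" "Inl j" "\<lambda>p. g w0 (p (Inl i)) - G w0" "\<lambda>(p, z). g w0 z - G w0"]
        kk_int[OF ij(1,2)] g_integrable I[OF ij(1)] I[OF ij(2)] ij(3) by (simp add: k_def)
    also have "(\<integral>z. g w0 z - G w0 \<partial>D) = 0"
      by (simp add: g_integrable integral_g D.prob_space)
    finally show ?thesis
      by simp
  qed
  have kk_sum: "(\<integral>\<omega>. (\<Sum>i = 1..b. \<Sum>j = 1..b. inner (k j \<omega>) (k i \<omega>)) \<partial>M)
      = (\<Sum>i = 1..b. \<Sum>j = 1..b. \<integral>\<omega>. inner (k j \<omega>) (k i \<omega>) \<partial>M)"
    by (subst Bochner_Integration.integral_sum)
       (intro Bochner_Integration.integrable_sum Bochner_Integration.integral_sum kk_int sum.cong refl;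
        assumption)+
  have v0: "v 0 \<omega> - G w0 = (1 / b) *\<^sub>R (\<Sum>i = 1..b. k i \<omega>)" for \<omega>
    using b_pos by (simp add: k_def sum_subtractf isarah_v.simps(1) scaleR_diff_right sum_constant_scaleR del: sum_constant)
  have "(norm (v 0 \<omega> - G w0))\<^sup>2 = (\<Sum>i = 1..b. \<Sum>j = 1..b. inner (k j \<omega>) (k i \<omega>)) / (real b)\<^sup>2" for \<omega>
    unfolding v0 power2_norm_eq_inner inner_scaleR_left inner_scaleR_right inner_sum_left inner_sum_right
    by (simp add: power2_eq_square sum_divide_distrib[symmetric])
  then have "(\<integral>\<omega>. (norm (v 0 \<omega> - G w0))\<^sup>2 \<partial>M)
      = (\<Sum>i = 1..b. \<Sum>j = 1..b. \<integral>\<omega>. inner (k j \<omega>) (k i \<omega>) \<partial>M) / (real b)\<^sup>2"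
    by (simp only: integral_divide_zero kk_sum)
  also have "\<dots> = (\<Sum>i = 1..b. \<Sum>j = 1..b. if j = i then \<integral>\<omega>. (norm (k i \<omega>))\<^sup>2 \<partial>M else 0) / (real b)\<^sup>2"
    using kk by (intro arg_cong2[where f = "(/)"] sum.cong refl) (auto simp: power2_norm_eq_inner)
  also have "\<dots> = (\<Sum>i = 1..b. \<integral>\<omega>. (norm (k i \<omega>))\<^sup>2 \<partial>M) / (real b)\<^sup>2"
    by simp
  also have "\<dots> \<le> (\<Sum>i = 1..b. ?Q) / (real b)\<^sup>2"
    by (intro divide_right_mono sum_mono k_le) auto
  also have "\<dots> = ?Q / b"
    by (simp add: power2_eq_square)
  finally show ?thesis .
qed

text \<open>By Cauchy-Schwarz the square of an average is at most the average of the squares. The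
  bound later caps the telescoping sum of increments.\<close>

lemma integrable_norm2_v0: "integrable M (\<lambda>\<omega>. (norm (v 0 \<omega>))\<^sup>2)"
  and integral_norm2_v0_le: "(\<integral>\<omega>. (norm (v 0 \<omega>))\<^sup>2 \<partial>M) \<le> (\<integral>z. (norm (g w0 z))\<^sup>2 \<partial>D)"
proof -
  let ?Q = "\<integral>z. (norm (g w0 z))\<^sup>2 \<partial>D"
  let ?B = "\<lambda>\<omega>. (\<Sum>i = 1..b. (norm (g w0 (X (Inl i) \<omega>)))\<^sup>2) / b"
  have I: "Inl i \<in> I" if "i \<in> {1..b}" for i
    using that by (simp add: I_def)
  have le: "(norm (v 0 \<omega>))\<^sup>2 \<le> ?B \<omega>" for \<omega>
  proof -
    have "norm (v 0 \<omega>) = norm (\<Sum>i = 1..b. g w0 (X (Inl i) \<omega>)) / b"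
      by (simp add: isarah_v.simps(1))
    also have "\<dots> \<le> (\<Sum>i = 1..b. norm (g w0 (X (Inl i) \<omega>))) / b"
      by (intro divide_right_mono norm_sum) simp
    finally have "(norm (v 0 \<omega>))\<^sup>2 \<le> ((\<Sum>i = 1..b. norm (g w0 (X (Inl i) \<omega>))) / b)\<^sup>2"
      by (intro power_mono) auto
    also have "\<dots> \<le> ((\<Sum>i = 1..b. (norm (g w0 (X (Inl i) \<omega>)))\<^sup>2) * b) / (real b)\<^sup>2"
      unfolding power_divide
      using sum_squared_le_sum_of_squares[of "\<lambda>i. norm (g w0 (X (Inl i) \<omega>))" "{1..b}"]
      by (intro divide_right_mono) auto
    finally show ?thesis
      using b_pos by (simp add: power2_eq_square)
  qed
  have int: "integrable M ?B"
    by (intro integrable_divide Bochner_Integration.integrable_sum norm_g_X(1) I)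
  show "integrable M (\<lambda>\<omega>. (norm (v 0 \<omega>))\<^sup>2)"
    by (rule Bochner_Integration.integrable_bound[OF int])
       (measurable, auto intro!: AE_I2 order_trans[OF le] divide_right_mono)
  then have "(\<integral>\<omega>. (norm (v 0 \<omega>))\<^sup>2 \<partial>M) \<le> (\<integral>\<omega>. ?B \<omega> \<partial>M)"
    using int le by (intro integral_mono) auto
  also have "\<dots> = ?Q"
    using norm_g_X[OF I] b_pos by simp
  finally show "(\<integral>\<omega>. (norm (v 0 \<omega>))\<^sup>2 \<partial>M) \<le> ?Q" .
qed

text \<open>Cocoercivity of the sampled gradient along the step \<open>- \<eta> v\<^sub>t\<close> makes \<open>\<parallel>v\<^sub>t\<parallel>\<close> nonincreasing
  along every sample path, and the decrease pays for the increment of \<open>v\<close>.\<close>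

lemma norm2_v_increment_le:
  assumes "\<omega> \<in> space M"
  shows "(norm (v (Suc t) \<omega> - v t \<omega>))\<^sup>2 \<le> L * \<eta> * ((norm (v t \<omega>))\<^sup>2 - (norm (v (Suc t) \<omega>))\<^sup>2)"
proof -
  define d where "d = v (Suc t) \<omega> - v t \<omega>"
  have "X (Inr (Suc t)) \<omega> \<in> space D"
    using measurable_space[OF X_measurable assms] by (simp add: I_def)
  from g_cocoercive[OF this, of "w (Suc t) \<omega>" "w t \<omega>"]
  have co: "(norm d)\<^sup>2 \<le> - (L * \<eta>) * inner d (v t \<omega>)"
    by (simp add: d_def isarah_v.simps(2) isarah_w.simps(2))
  have "(norm (v (Suc t) \<omega>))\<^sup>2 = (norm (v t \<omega> + d))\<^sup>2"
    by (simp add: d_def)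
  also have "\<dots> = (norm (v t \<omega>))\<^sup>2 + 2 * inner d (v t \<omega>) + (norm d)\<^sup>2"
    by (simp add: power2_norm_eq_inner inner_add_left inner_add_right inner_commute)
  finally have "L * \<eta> * ((norm (v t \<omega>))\<^sup>2 - (norm (v (Suc t) \<omega>))\<^sup>2)
      = 2 * (- (L * \<eta>) * inner d (v t \<omega>)) - L * \<eta> * (norm d)\<^sup>2"
    by (simp add: algebra_simps)
  \<comment> \<open>Cocoercivity supplies twice \<open>(norm d)\<^sup>2\<close>; one copy absorbs
    this term and the other is the claim.\<close>
  moreover have "L * \<eta> * (norm d)\<^sup>2 \<le> 1 * (norm d)\<^sup>2"
    using L_eta by (intro mult_right_mono) auto
  ultimately show ?thesis
    using co unfolding d_def[symmetric] by linarith
qed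

section \<open>Square integrability along the run\<close>

lemma norm_v_le:
  assumes "\<omega> \<in> space M"
  shows "norm (v t \<omega>) \<le> norm (v 0 \<omega>)"
proof (induction t)
  case (Suc t)
  have "0 \<le> L * \<eta> * ((norm (v t \<omega>))\<^sup>2 - (norm (v (Suc t) \<omega>))\<^sup>2)"
    using norm2_v_increment_le[OF assms, of t] zero_le_power2 order_trans by blast
  then have "norm (v (Suc t) \<omega>) \<le> norm (v t \<omega>)"
    using mult_pos_pos[OF L_pos eta_pos] by (auto simp: zero_le_mult_iff intro: power2_le_imp_le)
  then show ?case
    using Suc by simp
qed simp

lemma norm_w_diff_le:
  assumes "\<omega> \<in> space M"
  shows "norm (w t \<omega> - w0) \<le> \<eta> * t * norm (v 0 \<omega>)"
proof (induction t)
  case (Suc t)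
  have "norm (w (Suc t) \<omega> - w0) = norm ((w t \<omega> - w0) - \<eta> *\<^sub>R v t \<omega>)"
    by (simp add: isarah_w.simps(2) algebra_simps)
  also have "\<dots> \<le> norm (w t \<omega> - w0) + norm (\<eta> *\<^sub>R v t \<omega>)"
    by (rule norm_triangle_ineq4)
  also have "\<dots> \<le> \<eta> * t * norm (v 0 \<omega>) + \<eta> * norm (v 0 \<omega>)"
    using norm_v_le[OF assms, of t] eta_pos by (intro add_mono Suc) simp
  finally show ?case
    by (simp add: algebra_simps)
qed (simp add: isarah_w.simps(1))

lemma norm_G_w_le:
  assumes "\<omega> \<in> space M"
  shows "norm (G (w t \<omega>)) \<le> norm (G w0) + L * \<eta> * t * norm (v 0 \<omega>)"
proof -
  have "norm (G (w t \<omega>)) \<le> norm (G w0) + norm (G (w t \<omega>) - G w0)"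
    by (rule norm_triangle_sub)
  also have "norm (G (w t \<omega>) - G w0) \<le> L * norm (w t \<omega> - w0)"
    by (rule G_lipschitz)
  also have "\<dots> \<le> L * (\<eta> * t * norm (v 0 \<omega>))"
    using L_pos by (intro mult_left_mono norm_w_diff_le assms) auto
  finally show ?thesis
    by (simp add: mult_ac)
qed

text \<open>All square integrability is reduced to that of \<open>v 0\<close>: estimates and true
  gradients are bounded, on every path, by affine functions of
  \<open>norm (v 0 \<omega>)\<close>.\<close>

lemma integrable_norm2_of_bound:
  fixes u :: "'p \<Rightarrow> real ^ 'd"
  assumes [measurable]: "u \<in> borel_measurable M"
    and le: "\<And>\<omega>. \<omega> \<in> space M \<Longrightarrow> norm (u \<omega>) \<le> A + B * norm (v 0 \<omega>)"
  shows "integrable M (\<lambda>\<omega>. (norm (u \<omega>))\<^sup>2)"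
proof (rule Bochner_Integration.integrable_bound)
  show "integrable M (\<lambda>\<omega>. 2 * A\<^sup>2 + 2 * B\<^sup>2 * (norm (v 0 \<omega>))\<^sup>2)"
    using integrable_norm2_v0 by auto
  show "AE \<omega> in M. norm ((norm (u \<omega>))\<^sup>2) \<le> norm (2 * A\<^sup>2 + 2 * B\<^sup>2 * (norm (v 0 \<omega>))\<^sup>2)"
  proof (rule AE_I2)
    fix \<omega> assume "\<omega> \<in> space M"
    then have "(norm (u \<omega>))\<^sup>2 \<le> (A + B * norm (v 0 \<omega>))\<^sup>2"
      by (intro power_mono le) auto
    also have "\<dots> \<le> 2 * A\<^sup>2 + 2 * B\<^sup>2 * (norm (v 0 \<omega>))\<^sup>2"
      using sum_squares_bound[of A "B * norm (v 0 \<omega>)"] by (simp add: power2_sum power_mult_distrib)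
    finally show "norm ((norm (u \<omega>))\<^sup>2) \<le> norm (2 * A\<^sup>2 + 2 * B\<^sup>2 * (norm (v 0 \<omega>))\<^sup>2)"
      by simp
  qed
qed measurable

lemma integrable_norm2_v: "integrable M (\<lambda>\<omega>. (norm (v t \<omega>))\<^sup>2)"
  by (rule integrable_norm2_of_bound[where A = 0 and B = 1]) (use norm_v_le in auto)

lemma integrable_norm2_G_w: "integrable M (\<lambda>\<omega>. (norm (G (w t \<omega>)))\<^sup>2)"
  using norm_G_w_le by (intro integrable_norm2_of_bound) auto

section \<open>Mean-square error of the gradient estimate\<close>

lemma integrable_norm2_diff:
  fixes u u' :: "'p \<Rightarrow> real ^ 'd"
  assumes [measurable]: "u \<in> borel_measurable M" "u' \<in> borel_measurable M"
    and "integrable M (\<lambda>\<omega>. (norm (u \<omega>))\<^sup>2)" "integrable M (\<lambda>\<omega>. (norm (u' \<omega>))\<^sup>2)"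
  shows "integrable M (\<lambda>\<omega>. (norm (u \<omega> - u' \<omega>))\<^sup>2)"
proof -
  have "(norm (u \<omega> - u' \<omega>))\<^sup>2 = (norm (u \<omega>))\<^sup>2 - 2 * inner (u \<omega>) (u' \<omega>) + (norm (u' \<omega>))\<^sup>2" for \<omega>
    by (simp add: power2_norm_eq_inner inner_diff_left inner_diff_right inner_commute)
  then show ?thesis
    using assms integrable_inner_of_square_integrable[of u M u'] by simp
qed

text \<open>Given the samples used before step \<open>t + 1\<close>, the increment of \<open>v\<close> is an unbiased estimate of
  the increment of the gradient.\<close>

lemma increment_unbiased:
  "(\<integral>\<omega>. inner (G (w (Suc t) \<omega>) - v t \<omega>) (v (Suc t) \<omega> - v t \<omega>) \<partial>M)
    = (\<integral>\<omega>. inner (G (w (Suc t) \<omega>) - v t \<omega>) (G (w (Suc t) \<omega>) - G (w t \<omega>)) \<partial>M)"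
proof -
  let ?N = "PiM (J t) (\<lambda>_. D)"
  have in_I: "Inr (Suc t) \<in> I" "Inr (Suc t) \<notin> J t"
    by (auto simp: I_def J_def)
  have [measurable]: "W t \<in> borel_measurable ?N" "V t \<in> borel_measurable ?N" "W (Suc t) \<in> borel_measurable ?N"
    using path_measurable[of t "J t"] by auto
  have "integrable M (\<lambda>\<omega>. inner (G (w (Suc t) \<omega>) - v t \<omega>) (v (Suc t) \<omega> - v t \<omega>))"
    by (intro integrable_inner_of_square_integrable integrable_norm2_diff integrable_norm2_v
        integrable_norm2_G_w) measurable
  then show ?thesis
    \<comment> \<open>Already \<open>J t\<close> determines \<open>w (Suc t)\<close>, so both
      gradients of the increment are taken at points fixed before the fresh sample
      \<open>Inr (Suc t)\<close>.\<close>
    using integral_inner_samples[of "J t" "Inr (Suc t)" "\<lambda>p. G (W (Suc t) p) - V t p"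
        "\<lambda>(p, z). g (W (Suc t) p) z - g (W t p) z"]
    by (simp add: path_restrict[OF order_refl] g_integrable integral_g J_subset_I in_I isarah_v.simps(2) del: restrict_apply)
qed

lemma integral_norm2_error_step:
  "(\<integral>\<omega>. (norm (G (w (Suc t) \<omega>) - v (Suc t) \<omega>))\<^sup>2 \<partial>M)
    \<le> (\<integral>\<omega>. (norm (G (w t \<omega>) - v t \<omega>))\<^sup>2 \<partial>M) + (\<integral>\<omega>. (norm (v (Suc t) \<omega> - v t \<omega>))\<^sup>2 \<partial>M)"
proof -
  define e where "e t \<omega> = G (w t \<omega>) - v t \<omega>" for t \<omega>
  define a where "a \<omega> = G (w (Suc t) \<omega>) - G (w t \<omega>)" for \<omega>
  define d where "d \<omega> = v (Suc t) \<omega> - v t \<omega>" for \<omega>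
  define u where "u \<omega> = G (w (Suc t) \<omega>) - v t \<omega>" for \<omega>
  have [measurable]: "e t \<in> borel_measurable M" "a \<in> borel_measurable M" "d \<in> borel_measurable M"
    "u \<in> borel_measurable M" for t
    unfolding e_def a_def d_def u_def by measurable
  have int: "integrable M (\<lambda>\<omega>. (norm (e t \<omega>))\<^sup>2)" "integrable M (\<lambda>\<omega>. (norm (a \<omega>))\<^sup>2)"
    "integrable M (\<lambda>\<omega>. (norm (d \<omega>))\<^sup>2)" "integrable M (\<lambda>\<omega>. (norm (u \<omega>))\<^sup>2)" for t
    unfolding e_def a_def d_def u_def
    by (intro integrable_norm2_diff integrable_norm2_v integrable_norm2_G_w; measurable)+
  have uint: "integrable M (\<lambda>\<omega>. inner (u \<omega>) (a \<omega>))" "integrable M (\<lambda>\<omega>. inner (u \<omega>) (d \<omega>))"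
    by (intro integrable_inner_of_square_integrable int; measurable)+
  \<comment> \<open>The square is expanded around \<open>u\<close>, so that both cross terms share
    this factor and cancel in the mean by unbiasedness.\<close>
  have "(norm (e (Suc t) \<omega>))\<^sup>2 = (norm (e t \<omega>))\<^sup>2 - (norm (a \<omega>))\<^sup>2 + (norm (d \<omega>))\<^sup>2
      + 2 * (inner (u \<omega>) (a \<omega>) - inner (u \<omega>) (d \<omega>))" for \<omega>
  proof -
    have "e (Suc t) \<omega> = e t \<omega> + a \<omega> - d \<omega>" "u \<omega> = e t \<omega> + a \<omega>"
      by (simp_all add: e_def a_def d_def u_def)
    then show ?thesis
      by (simp add: power2_norm_eq_inner inner_add_left inner_add_right inner_diff_left
          inner_diff_right inner_commute)
  qed
  then have "(\<integral>\<omega>. (norm (e (Suc t) \<omega>))\<^sup>2 \<partial>M) = (\<integral>\<omega>. (norm (e t \<omega>))\<^sup>2 \<partial>M)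
      - (\<integral>\<omega>. (norm (a \<omega>))\<^sup>2 \<partial>M) + (\<integral>\<omega>. (norm (d \<omega>))\<^sup>2 \<partial>M)
      + 2 * ((\<integral>\<omega>. inner (u \<omega>) (a \<omega>) \<partial>M) - (\<integral>\<omega>. inner (u \<omega>) (d \<omega>) \<partial>M))"
    using int uint by simp
  moreover have "(\<integral>\<omega>. inner (u \<omega>) (d \<omega>) \<partial>M) = (\<integral>\<omega>. inner (u \<omega>) (a \<omega>) \<partial>M)"
    unfolding u_def d_def a_def by (rule increment_unbiased)
  moreover have "(\<integral>\<omega>. (norm (a \<omega>))\<^sup>2 \<partial>M) \<ge> 0"
    by simp
  ultimately have "(\<integral>\<omega>. (norm (e (Suc t) \<omega>))\<^sup>2 \<partial>M)
      \<le> (\<integral>\<omega>. (norm (e t \<omega>))\<^sup>2 \<partial>M) + (\<integral>\<omega>. (norm (d \<omega>))\<^sup>2 \<partial>M)"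
    by simp
  then show ?thesis
    unfolding e_def d_def .
qed

lemma integral_norm2_error_le:
  "(\<integral>\<omega>. (norm (G (w t \<omega>) - v t \<omega>))\<^sup>2 \<partial>M) \<le> (\<integral>z. (norm (g w0 z))\<^sup>2 \<partial>D) * (1 / b + L * \<eta>)"
proof -
  let ?Q = "\<integral>z. (norm (g w0 z))\<^sup>2 \<partial>D"
  have Leta0: "0 \<le> L * \<eta>"
    using L_pos eta_pos by simp
  \<comment> \<open>The induction needs this stronger bound: it keeps the second moment of
    \<open>v t\<close>, which makes the increments telescope. That term is dropped only
    afterwards.\<close>
  have "(\<integral>\<omega>. (norm (G (w t \<omega>) - v t \<omega>))\<^sup>2 \<partial>M)
      \<le> ?Q / b + L * \<eta> * ((\<integral>\<omega>. (norm (v 0 \<omega>))\<^sup>2 \<partial>M) - (\<integral>\<omega>. (norm (v t \<omega>))\<^sup>2 \<partial>M))"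
  proof (induction t)
    case 0
    show ?case
      using integral_norm2_v0_diff_le by (simp add: norm_minus_commute isarah_w.simps(1))
  next
    case (Suc t)
    have "(\<integral>\<omega>. (norm (v (Suc t) \<omega> - v t \<omega>))\<^sup>2 \<partial>M)
        \<le> (\<integral>\<omega>. L * \<eta> * ((norm (v t \<omega>))\<^sup>2 - (norm (v (Suc t) \<omega>))\<^sup>2) \<partial>M)"
      by (intro integral_mono norm2_v_increment_le integrable_norm2_diff integrable_mult_right
          Bochner_Integration.integrable_diff integrable_norm2_v) measurable
    also have "\<dots> = L * \<eta> * ((\<integral>\<omega>. (norm (v t \<omega>))\<^sup>2 \<partial>M) - (\<integral>\<omega>. (norm (v (Suc t) \<omega>))\<^sup>2 \<partial>M))"
      using integrable_norm2_v[of t] integrable_norm2_v[of "Suc t"] by simp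
    finally show ?case
      using Suc.IH integral_norm2_error_step[of t] by (simp add: algebra_simps)
  qed
  also have "\<dots> \<le> ?Q / b + L * \<eta> * ?Q"
  proof -
    have "(\<integral>\<omega>. (norm (v t \<omega>))\<^sup>2 \<partial>M) \<ge> 0"
      by simp
    then have "(\<integral>\<omega>. (norm (v 0 \<omega>))\<^sup>2 \<partial>M) - (\<integral>\<omega>. (norm (v t \<omega>))\<^sup>2 \<partial>M) \<le> ?Q"
      using integral_norm2_v0_le by linarith
    then show ?thesis
      by (intro add_left_mono mult_left_mono Leta0)
  qed
  finally show ?thesis
    by (simp add: algebra_simps)
qed

section \<open>Descent of the objective along a sample path\<close>

text \<open>Polarization rewrites the inner product of gradient and estimate through their squares
  and that of the error. Since \<open>L * \<eta> \<le> 1\<close>, the negative square of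
  \<open>v t\<close> absorbs the quadratic term of the descent lemma, and the values of
  \<open>F\<close> telescope.\<close>

lemma sum_norm2_G_w_le:
  "(\<Sum>t<n. (norm (G (w t \<omega>)))\<^sup>2) \<le> 2 / \<eta> * (F w0 - F wstar) + (\<Sum>t<n. (norm (G (w t \<omega>) - v t \<omega>))\<^sup>2)"
proof -
  have step: "\<eta> / 2 * (norm (G (w t \<omega>)))\<^sup>2
      \<le> F (w t \<omega>) - F (w (Suc t) \<omega>) + \<eta> / 2 * (norm (G (w t \<omega>) - v t \<omega>))\<^sup>2" for t
  proof -
    have "F (w (Suc t) \<omega>) \<le> F (w t \<omega>) + inner (G (w t \<omega>)) (w (Suc t) \<omega> - w t \<omega>)
        + L / 2 * (norm (w (Suc t) \<omega> - w t \<omega>))\<^sup>2"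
      by (rule lipschitz_grad_upper_bound[OF F_differentiable G_lipschitz])
    also have "\<dots> = F (w t \<omega>) - \<eta> * inner (G (w t \<omega>)) (v t \<omega>) + \<eta> / 2 * (L * \<eta>) * (norm (v t \<omega>))\<^sup>2"
      by (simp add: isarah_w.simps(2) power_mult_distrib power2_eq_square)
    also have "\<dots> \<le> F (w t \<omega>) - \<eta> * inner (G (w t \<omega>)) (v t \<omega>) + \<eta> / 2 * 1 * (norm (v t \<omega>))\<^sup>2"
      using L_eta eta_pos by (intro add_left_mono mult_right_mono mult_left_mono) auto
    finally show ?thesis
      by (simp add: power2_norm_eq_inner inner_diff_left inner_diff_right inner_commute algebra_simps)
  qed
  have "\<eta> / 2 * (\<Sum>t<n. (norm (G (w t \<omega>)))\<^sup>2)
      \<le> (\<Sum>t<n. F (w t \<omega>) - F (w (Suc t) \<omega>)) + \<eta> / 2 * (\<Sum>t<n. (norm (G (w t \<omega>) - v t \<omega>))\<^sup>2)"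
    unfolding sum_distrib_left sum.distrib[symmetric] by (intro sum_mono step)
  also have "(\<Sum>t<n. F (w t \<omega>) - F (w (Suc t) \<omega>)) = F w0 - F (w n \<omega>)"
    using sum_lessThan_telescope'[of "\<lambda>t. F (w t \<omega>)" n] by (simp add: isarah_w.simps(1))
  also have "\<dots> \<le> F w0 - F wstar"
    using minimizer by simp
  finally show ?thesis
    using eta_pos by (simp add: field_simps)
qed

section \<open>The random output index\<close>

text \<open>Any iterate is a function of the whole sample family, from which \<open>\<tau>\<close>
  is independent. Expectations restricted to \<open>\<tau> = t\<close> therefore factor.\<close>

lemma indep_tau_w:
  "prob_space.indep_var M borel (\<lambda>\<omega>. indicator {t} (\<tau> \<omega>) :: real) borel (\<lambda>\<omega>. (norm (G (w s \<omega>)))\<^sup>2)"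
proof (rule M.indep_var_of_indep_set[OF indep_tau])
  show "(\<lambda>\<omega>. indicator {t} (\<tau> \<omega>) :: real) \<in> borel_measurable (vimage_algebra (space M) \<tau> (count_space UNIV))"
    by (rule measurable_compose[OF measurable_vimage_algebra1]) auto
  have "J s \<subseteq> I"
    by (rule J_subset_I)
  then have "W s \<in> borel_measurable (PiM I (\<lambda>_. D))"
    using path_measurable by blast
  then have meas: "(\<lambda>p. (norm (G (W s p)))\<^sup>2) \<in> borel_measurable (PiM I (\<lambda>_. D))"
    by measurable
  have "(\<lambda>\<omega>. \<lambda>j\<in>I. X j \<omega>)
      \<in> measurable (vimage_algebra (space M) (\<lambda>\<omega>. \<lambda>j\<in>I. X j \<omega>) (PiM I (\<lambda>_. D))) (PiM I (\<lambda>_. D))"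
    by (rule measurable_vimage_algebra1) (use samples_measurable[OF order_refl] in \<open>auto dest: measurable_space\<close>)
  from measurable_compose[OF this meas] show "(\<lambda>\<omega>. (norm (G (w s \<omega>)))\<^sup>2)
      \<in> borel_measurable (vimage_algebra (space M) (\<lambda>\<omega>. \<lambda>j\<in>I. X j \<omega>) (PiM I (\<lambda>_. D)))"
    by (simp only: path_restrict(1)[OF \<open>J s \<subseteq> I\<close>])
qed auto

lemma integral_tau_w:
  assumes "t \<le> m"
  shows "(\<integral>\<omega>. indicator {t} (\<tau> \<omega>) * (norm (G (w t \<omega>)))\<^sup>2 \<partial>M) = (\<integral>\<omega>. (norm (G (w t \<omega>)))\<^sup>2 \<partial>M) / (m + 1)"
    and "integrable M (\<lambda>\<omega>. indicator {t} (\<tau> \<omega>) * (norm (G (w t \<omega>)))\<^sup>2)"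
proof -
  have int: "integrable M (\<lambda>\<omega>. indicator {t} (\<tau> \<omega>) :: real)"
    by (rule M.integrable_const_bound[where B = 1]) (auto simp: indicator_def)
  have "(\<integral>\<omega>. indicator {t} (\<tau> \<omega>) \<partial>M) = (\<integral>i. indicator {t} i \<partial>distr M (count_space UNIV) \<tau> :: real)"
    by (rule integral_distr[symmetric]) auto
  also have "\<dots> = 1 / (m + 1)"
    unfolding distr_tau using assms by (simp add: measure_pmf_single)
  finally show "(\<integral>\<omega>. indicator {t} (\<tau> \<omega>) * (norm (G (w t \<omega>)))\<^sup>2 \<partial>M)
      = (\<integral>\<omega>. (norm (G (w t \<omega>)))\<^sup>2 \<partial>M) / (m + 1)"
    using M.indep_var_lebesgue_integral[OF indep_tau_w int integrable_norm2_G_w] by simp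
  show "integrable M (\<lambda>\<omega>. indicator {t} (\<tau> \<omega>) * (norm (G (w t \<omega>)))\<^sup>2)"
    by (rule M.indep_var_integrable[OF indep_tau_w int integrable_norm2_G_w])
qed

lemma output_bound:
  defines "h \<equiv> \<lambda>\<omega>. (norm (G (isarah_output f w0 \<eta> b \<zeta> \<xi> \<tau> \<omega>)))\<^sup>2"
  shows "integrable M h"
    and "(\<integral>\<omega>. h \<omega> \<partial>M) \<le> 2 * (F w0 - F wstar) / (\<eta> * (m + 1))
      + (4 * L * (F w0 - F wstar) + 2 * \<sigma>\<^sup>2) * (1 / b + L * \<eta>)"
proof -
  let ?Q = "\<integral>z. (norm (g w0 z))\<^sup>2 \<partial>D" and ?c = "1 / b + L * \<eta>" and ?n = "Suc m"
  let ?S = "\<lambda>\<omega>. \<Sum>t<?n. indicator {t} (\<tau> \<omega>) * (norm (G (w t \<omega>)))\<^sup>2"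
  have h: "h \<omega> = (norm (G (w (\<tau> \<omega>) \<omega>)))\<^sup>2" for \<omega>
    by (simp add: h_def isarah_output_def X_def)
  have [measurable]: "h \<in> borel_measurable M"
    unfolding h by (rule measurable_compose_countable[where f = "\<lambda>t \<omega>. (norm (G (w t \<omega>)))\<^sup>2"]) measurable
  have "AE i in distr M (count_space UNIV) \<tau>. i < ?n"
    unfolding distr_tau by (auto simp: AE_measure_pmf_iff)
  \<comment> \<open>Only the law of \<open>\<tau>\<close> is prescribed, so \<open>\<tau>\<close>
    may exceed \<open>m\<close> on a null set; the split by output index holds almost
    everywhere.\<close>
  then have "AE \<omega> in M. \<tau> \<omega> < ?n"
    by (subst (asm) AE_distr_iff) auto
  then have AE: "AE \<omega> in M. h \<omega> = ?S \<omega>"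
    by (rule eventually_mono) (simp add: h indicator_def if_distrib[of "\<lambda>x. x * _"] cong: if_cong del: sum.lessThan_Suc)
  have intS: "integrable M ?S"
    by (intro Bochner_Integration.integrable_sum integral_tau_w) auto
  show "integrable M h"
    using intS AE by (subst integrable_cong_AE[where g = ?S]) (auto intro: borel_measurable_integrable)
  have "(\<integral>\<omega>. h \<omega> \<partial>M) = (\<integral>\<omega>. ?S \<omega> \<partial>M)"
    using intS AE by (intro integral_cong_AE) (auto intro: borel_measurable_integrable)
  also have "\<dots> = (\<Sum>t<?n. (\<integral>\<omega>. (norm (G (w t \<omega>)))\<^sup>2 \<partial>M) / (m + 1))"
    using integral_tau_w by (subst Bochner_Integration.integral_sum) (auto intro!: sum.cong simp del: sum.lessThan_Suc)
  also have "\<dots> = (\<integral>\<omega>. (\<Sum>t<?n. (norm (G (w t \<omega>)))\<^sup>2) \<partial>M) / (m + 1)"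
    by (simp add: sum_divide_distrib[symmetric] integrable_norm2_G_w del: sum.lessThan_Suc)
  also have "\<dots> \<le> (2 / \<eta> * (F w0 - F wstar) + (m + 1) * (?Q * ?c)) / (m + 1)"
  proof (rule divide_right_mono)
    have int: "integrable M (\<lambda>\<omega>. (norm (G (w t \<omega>) - v t \<omega>))\<^sup>2)" for t
      by (intro integrable_norm2_diff integrable_norm2_v integrable_norm2_G_w) measurable
    have "(\<integral>\<omega>. (\<Sum>t<?n. (norm (G (w t \<omega>)))\<^sup>2) \<partial>M)
        \<le> (\<integral>\<omega>. 2 / \<eta> * (F w0 - F wstar) + (\<Sum>t<?n. (norm (G (w t \<omega>) - v t \<omega>))\<^sup>2) \<partial>M)"
      by (intro integral_mono sum_norm2_G_w_le Bochner_Integration.integrable_sum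
          Bochner_Integration.integrable_add integrable_norm2_G_w int) simp
    also have "\<dots> = 2 / \<eta> * (F w0 - F wstar) + (\<Sum>t<?n. \<integral>\<omega>. (norm (G (w t \<omega>) - v t \<omega>))\<^sup>2 \<partial>M)"
      using int by (simp add: M.prob_space del: sum.lessThan_Suc)
    also have "(\<Sum>t<?n. \<integral>\<omega>. (norm (G (w t \<omega>) - v t \<omega>))\<^sup>2 \<partial>M) \<le> (\<Sum>t<?n. ?Q * ?c)"
      by (intro sum_mono integral_norm2_error_le)
    finally show "(\<integral>\<omega>. (\<Sum>t<?n. (norm (G (w t \<omega>)))\<^sup>2) \<partial>M)
        \<le> 2 / \<eta> * (F w0 - F wstar) + (m + 1) * (?Q * ?c)"
      by (simp add: add.commute)
  qed simp
  also have "\<dots> = 2 * (F w0 - F wstar) / (\<eta> * (m + 1)) + ?Q * ?c"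
    by (simp add: add_divide_distrib)
  also have "?Q * ?c \<le> (4 * L * (F w0 - F wstar) + 2 * \<sigma>\<^sup>2) * ?c"
    using L_pos eta_pos by (intro mult_right_mono integral_norm2_g_le) auto
  finally show "(\<integral>\<omega>. h \<omega> \<partial>M) \<le> 2 * (F w0 - F wstar) / (\<eta> * (m + 1))
      + (4 * L * (F w0 - F wstar) + 2 * \<sigma>\<^sup>2) * (1 / b + L * \<eta>)"
    by simp
qed

end

section \<open>Convergence rate and complexity for the prescribed parameters\<close>

lemma (in smooth_convex_objective) isarah_rate:
  fixes m b :: nat and M :: "'p measure" and w0 :: "real ^ 'd"
  assumes b: "real b = 2 * sqrt (real m + 1)" and samples: "isarah_samples D m b M \<zeta> \<xi> \<tau>"
  defines "h \<equiv> \<lambda>\<omega>. (norm (G (isarah_output f w0 (1 / (L * sqrt (real m + 1))) b \<zeta> \<xi> \<tau> \<omega>)))\<^sup>2"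
  shows "integrable M h \<and>
    (\<integral>\<omega>. h \<omega> \<partial>M) \<le> rate_factor (F w0 - F wstar) * (max L (\<sigma>\<^sup>2) / sqrt (real m + 1))"
proof -
  define s where "s = sqrt (real m + 1)"
  define \<Delta> where "\<Delta> = F w0 - F wstar"
  define K where "K = max L (\<sigma>\<^sup>2)"
  have s: "s \<ge> 1" "real m + 1 = s\<^sup>2" "real b = 2 * s"
    using b by (simp_all add: s_def)
  have "\<Delta> \<ge> 0"
    using minimizer by (simp add: \<Delta>_def)
  interpret isarah_run D f L \<sigma> wstar w0 "1 / (L * s)" m b M \<zeta> \<xi> \<tau>
    using s L_pos samples by unfold_locales auto
  have h: "h = (\<lambda>\<omega>. (norm (G (isarah_output f w0 (1 / (L * s)) b \<zeta> \<xi> \<tau> \<omega>)))\<^sup>2)"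
    by (simp add: h_def s_def)
  have "(\<integral>\<omega>. h \<omega> \<partial>M) \<le> 2 * \<Delta> / (1 / (L * s) * (m + 1))
      + (4 * L * \<Delta> + 2 * \<sigma>\<^sup>2) * (1 / b + L * (1 / (L * s)))"
    using output_bound(2) unfolding h \<Delta>_def .
  also have "1 / (L * s) * (m + 1) = s / L"
    using s by (simp add: add.commute power2_eq_square)
  \<comment> \<open>The first term is \<open>2 * L * \<Delta> / s\<close>. The bracket
    \<open>1 / b + L * \<eta>\<close> equals \<open>3 / (2 * s)\<close>, which adds
    \<open>6 * L * \<Delta> + 3 * \<sigma>\<^sup>2\<close> over \<open>s\<close>.\<close>
  also have "2 * \<Delta> / (s / L) + (4 * L * \<Delta> + 2 * \<sigma>\<^sup>2) * (1 / b + L * (1 / (L * s)))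
      = (8 * (L * \<Delta>) + 3 * \<sigma>\<^sup>2) / s"
    using s L_pos by (simp add: field_simps)
  also have "\<dots> \<le> (10 * (K * \<Delta>) + 10 * K) / s"
  proof (rule divide_right_mono)
    have "L * \<Delta> \<le> K * \<Delta>" "\<sigma>\<^sup>2 \<le> K" "0 \<le> L * \<Delta>" "0 \<le> K"
      using \<open>\<Delta> \<ge> 0\<close> L_pos by (auto simp: K_def intro!: mult_right_mono)
    then show "8 * (L * \<Delta>) + 3 * \<sigma>\<^sup>2 \<le> 10 * (K * \<Delta>) + 10 * K"
      by linarith
  qed (use s in simp)
  also have "\<dots> = rate_factor \<Delta> * (K / s)"
    by (simp add: rate_factor_def algebra_simps add_divide_distrib)
  finally show ?thesis
    using output_bound(1) unfolding h \<Delta>_def K_def s_def by blast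
qed

theorem corollary2:
  fixes D :: "'z measure" and f :: "real ^ 'd \<Rightarrow> 'z \<Rightarrow> real"
    and L \<sigma> :: real and w0 wstar :: "real ^ 'd"
  defines "F \<equiv> expected_loss D f"
  assumes objective: "stochastic_objective D f"
    and convex: "\<forall>z\<in>space D. convex_on UNIV (\<lambda>w. f w z)"
    and L_pos: "L > 0"
    and smooth: "smooth_realizations D f L"
    and minimizer: "\<forall>w. F wstar \<le> F w"
    and sigma_pos: "\<sigma> > 0"
    and sigma_int: "integrable D (\<lambda>z. (norm (stoch_grad f wstar z))\<^sup>2)"
    and sigma_bound: "(\<integral>z. (norm (stoch_grad f wstar z))\<^sup>2 \<partial>D) \<le> \<sigma>\<^sup>2"
  shows
    "(\<forall>m b (M :: 'p measure) \<zeta> \<xi> \<tau>.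
        m > 0 \<longrightarrow> real b = 2 * sqrt (real m + 1) \<longrightarrow> isarah_samples D m b M \<zeta> \<xi> \<tau> \<longrightarrow>
        (let \<eta> = 1 / (L * sqrt (real m + 1));
             g = (\<lambda>\<omega>. (norm (grad F (isarah_output f w0 \<eta> b \<zeta> \<xi> \<tau> \<omega>)))\<^sup>2)
         in integrable M g \<and>
            (\<integral>\<omega>. g \<omega> \<partial>M) \<le> rate_factor (F w0 - F wstar) * (max L (\<sigma>\<^sup>2) / sqrt (real m + 1))))
     \<and>
     (\<forall>\<^sub>F \<epsilon> in at_right 0. \<exists>m b.
        m > 0 \<and> real b = 2 * sqrt (real m + 1) \<and>
        (\<forall>(M :: 'p measure) \<zeta> \<xi> \<tau>. isarah_samples D m b M \<zeta> \<xi> \<tau> \<longrightarrow>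
           (let \<eta> = 1 / (L * sqrt (real m + 1));
                g = (\<lambda>\<omega>. (norm (grad F (isarah_output f w0 \<eta> b \<zeta> \<xi> \<tau> \<omega>)))\<^sup>2)
            in integrable M g \<and> (\<integral>\<omega>. g \<omega> \<partial>M) \<le> \<epsilon>)) \<and>
        real (isarah_complexity m b) \<le>
          complexity_factor (F w0 - F wstar) *
            (max L (\<sigma>\<^sup>2) / \<epsilon> + max (L\<^sup>2) (\<sigma> ^ 4) / \<epsilon>\<^sup>2))"
proof -
  interpret objective: smooth_convex_objective D f L \<sigma> wstar
    using assms by unfold_locales auto
  define R where "R = rate_factor (F w0 - F wstar)"
  define K where "K = max L (\<sigma>\<^sup>2)"
  have rate: "integrable M (\<lambda>\<omega>. (norm (grad F (isarah_output f w0 (1 / (L * sqrt (real m + 1))) b \<zeta> \<xi> \<tau> \<omega>)))\<^sup>2) \<and>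
      (\<integral>\<omega>. (norm (grad F (isarah_output f w0 (1 / (L * sqrt (real m + 1))) b \<zeta> \<xi> \<tau> \<omega>)))\<^sup>2 \<partial>M)
        \<le> R * (K / sqrt (real m + 1))"
    if "real b = 2 * sqrt (real m + 1)" "isarah_samples D m b M \<zeta> \<xi> \<tau>"
    for m b and M :: "'p measure" and \<zeta> \<xi> \<tau>
    unfolding F_def R_def K_def by (rule objective.isarah_rate[OF that])
  have "K > 0"
    using L_pos by (simp add: K_def)
  have "R \<ge> 10"
    using minimizer by (simp add: R_def rate_factor_def)
  \<comment> \<open>Squaring is monotone on nonnegative numbers, so it commutes with the
    maximum.\<close>
  have K2: "max (L\<^sup>2) (\<sigma> ^ 4) = K\<^sup>2"
  proof -
    have "(\<sigma>\<^sup>2)\<^sup>2 = \<sigma> ^ 4"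
      by simp
    moreover have "L \<le> \<sigma>\<^sup>2 \<longleftrightarrow> L\<^sup>2 \<le> (\<sigma>\<^sup>2)\<^sup>2"
      using L_pos by (intro power_mono_iff[symmetric]) auto
    ultimately show ?thesis
      by (simp add: K_def max_def)
  qed
  have "\<exists>m b. m > 0 \<and> real b = 2 * sqrt (real m + 1) \<and> R * (K / sqrt (real m + 1)) \<le> \<epsilon> \<and>
      real (isarah_complexity m b) \<le> 10 * R\<^sup>2 * (K / \<epsilon> + K\<^sup>2 / \<epsilon>\<^sup>2)"
    if \<epsilon>: "0 < \<epsilon>" "\<epsilon> < K" for \<epsilon>
  proof -
    \<comment> \<open>The rate bound is at most \<open>\<epsilon>\<close> exactly when
      \<open>sqrt (real m + 1)\<close> is at least \<open>x\<close>. Rounding \<open>x\<close> up to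
      an integer \<open>s\<close> and making \<open>m + 1\<close> its square also makes the batch
      size \<open>2 * s\<close> an integer.\<close>
    define x where "x = R * (K / \<epsilon>)"
    define s where "s = nat \<lceil>x\<rceil>"
    define m where "m = s\<^sup>2 - 1"
    have "x \<ge> 10 * 1"
      unfolding x_def using \<open>R \<ge> 10\<close> \<epsilon> by (intro mult_mono) auto
    then have s: "x \<le> real s" "real s \<le> x + 1"
      by (simp_all add: s_def)
    then have "s \<ge> 2"
      using \<open>x \<ge> 10 * 1\<close> by linarith
    \<comment> \<open>With \<open>s\<close> at least 2 the subtraction in \<open>m\<close> does not
      truncate and \<open>m\<close> is positive.\<close>
    then have s2: "s\<^sup>2 \<ge> 2\<^sup>2"
      by (intro power_mono) auto
    then have m: "real m + 1 = (real s)\<^sup>2" "m > 0"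
      by (auto simp: m_def)
    then have sqrt: "sqrt (real m + 1) = real s"
      by simp
    have "R * K \<le> \<epsilon> * real s"
      using s(1) \<epsilon> by (simp add: x_def field_simps)
    then have "R * (K / real s) \<le> \<epsilon>"
      using \<open>s \<ge> 2\<close> by (simp add: field_simps)
    moreover have "real (isarah_complexity m (2 * s)) \<le> 10 * R\<^sup>2 * (K / \<epsilon> + K\<^sup>2 / \<epsilon>\<^sup>2)"
    proof -
      have "real (isarah_complexity m (2 * s)) = 2 * real s + 2 * (real s)\<^sup>2 - 2"
        using m by (simp add: isarah_complexity_def)
      also have "\<dots> \<le> 2 * (x + 1) + 2 * (x + 1)\<^sup>2 - 2"
        using s(2) by (intro add_mono diff_right_mono mult_left_mono power_mono) auto
      also have "\<dots> = 2 * x\<^sup>2 + 6 * x + 2"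
        by (simp add: power2_eq_square algebra_simps)
      \<comment> \<open>Since \<open>x \<ge> 10\<close>, the lower-order terms are absorbed by the
        square; this is the source of the 10 in \<open>complexity_factor\<close>.\<close>
      also have "\<dots> \<le> 10 * x\<^sup>2"
      proof -
        have "10 * x \<le> x * x"
          using \<open>x \<ge> 10 * 1\<close> by (intro mult_right_mono) auto
        then show ?thesis
          using \<open>x \<ge> 10 * 1\<close> unfolding power2_eq_square by linarith
      qed
      also have "\<dots> = 10 * R\<^sup>2 * (K\<^sup>2 / \<epsilon>\<^sup>2)"
        by (simp add: x_def power_mult_distrib power_divide)
      also have "\<dots> \<le> 10 * R\<^sup>2 * (K / \<epsilon> + K\<^sup>2 / \<epsilon>\<^sup>2)"
        using \<open>K > 0\<close> \<epsilon> by (intro mult_left_mono) auto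
      finally show ?thesis .
    qed
    ultimately show ?thesis
      using m(2) sqrt by (intro exI[of _ m] exI[of _ "2 * s"]) simp
  qed
  \<comment> \<open>The witnesses \<open>m\<close> and \<open>b\<close> depend on
    \<open>\<epsilon>\<close> alone among the bound variables and are chosen before \<open>M\<close>
    and the samples, so one choice serves all runs.\<close>
  then have small: "\<exists>m b. m > 0 \<and> real b = 2 * sqrt (real m + 1) \<and>
        (\<forall>(M :: 'p measure) \<zeta> \<xi> \<tau>. isarah_samples D m b M \<zeta> \<xi> \<tau> \<longrightarrow>
           integrable M (\<lambda>\<omega>. (norm (grad F (isarah_output f w0 (1 / (L * sqrt (real m + 1))) b \<zeta> \<xi> \<tau> \<omega>)))\<^sup>2) \<and>
           (\<integral>\<omega>. (norm (grad F (isarah_output f w0 (1 / (L * sqrt (real m + 1))) b \<zeta> \<xi> \<tau> \<omega>)))\<^sup>2 \<partial>M) \<le> \<epsilon>) \<and>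
        real (isarah_complexity m b) \<le> 10 * R\<^sup>2 * (K / \<epsilon> + K\<^sup>2 / \<epsilon>\<^sup>2)"
    if "0 < \<epsilon>" "\<epsilon> < K" for \<epsilon>
    using that rate order_trans by meson
  have "\<forall>\<^sub>F \<epsilon> in at_right 0. \<epsilon> \<in> {0<..<K}"
    using \<open>K > 0\<close> by (rule eventually_at_right_real)
  then have "\<forall>\<^sub>F \<epsilon> in at_right 0. \<exists>m b. m > 0 \<and> real b = 2 * sqrt (real m + 1) \<and>
        (\<forall>(M :: 'p measure) \<zeta> \<xi> \<tau>. isarah_samples D m b M \<zeta> \<xi> \<tau> \<longrightarrow>
           integrable M (\<lambda>\<omega>. (norm (grad F (isarah_output f w0 (1 / (L * sqrt (real m + 1))) b \<zeta> \<xi> \<tau> \<omega>)))\<^sup>2) \<and>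
           (\<integral>\<omega>. (norm (grad F (isarah_output f w0 (1 / (L * sqrt (real m + 1))) b \<zeta> \<xi> \<tau> \<omega>)))\<^sup>2 \<partial>M) \<le> \<epsilon>) \<and>
        real (isarah_complexity m b) \<le> 10 * R\<^sup>2 * (K / \<epsilon> + K\<^sup>2 / \<epsilon>\<^sup>2)"
    by (rule eventually_mono) (rule small; simp)
  then show ?thesis
    using rate unfolding Let_def K2 complexity_factor_def R_def[symmetric] K_def[symmetric] by blast
qed

end
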